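(* Let $n\geq 1$, $\nu\geq 1$, $k\geq 3$. Suppose that $w\in F_n$ is a positive word of length $k$ that is not a proper power, and let $\mathcal{Q}$ be the multiset of the integers $q$ ($0\leq q<n$), one for each length-two cyclic subword $x_ix_{i+q}$ of $w$ (subscripts mod $n$). Suppose that the cyclic presentation $P_n(w)$ is irreducible and non-redundant. Then $P_n(w)$ is $(3,k,\nu)$-special if and only if all of the following hold: (a) $n=\nu N$, where $N=k^2-k+1$; (b) $\mathcal{Q}$ is a perfect difference set; (c) $q\equiv q'$ mod $\nu$ for all $q,q'\in\mathcal{Q}$; (d) $\nu\mid k$.
   Context: Cyclic presentations: $F_n$ is the free group with basis $x_0,\ldots,x_{n-1}$ and $\theta:F_n\to F_n$ is the automorphism $\theta(x_i)=x_{i+1}$ (subscripts mod $n$). For a cyclically reduced word $w\in F_n$, $P_n(w)=\langle x_0,\ldots,x_{n-1}\mid w,\theta(w),\ldots,\theta^{n-1}(w)\rangle$. Throughout it is assumed that $x_0$ is a letter of $w$. $P_n(w)$ is irreducible if the greatest common divisor of $n$ and the subscripts of the generators appearing in $w$ is $1$. A word is positive if all exponents of its generators are positive. The word $w$ is a proper power if $w=v^t$ for some $v$ and some $t\geq 2$. Non-redundant: a relator $r\in R$ of $\langle X\mid R\rangle$ is freely redundant if it is freely trivial or there is $s\in R$ such that $r,s$ are distinct elements of the free group on $X$ and $r$ is freely conjugate to $s$ or to $s^{-1}$. A presentation is non-redundant if it contains no freely redundant relator. Perfect difference set: a set (here multiset) of $k$ integers $d_1,\ldots,d_k$ is a perfect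 difference set (of order $k$) if among the $k(k-1)$ differences $d_i-d_j$ ($i\neq j$) each of the residues $1,2,\ldots,k^2-k$ mod $k^2-k+1$ occurs exactly once. Star graph: let $\tilde R$ be the set of all cyclic permutations of elements of $R\cup R^{-1}$. The star graph of $\langle X\mid R\rangle$ (all relators cyclically reduced) is the undirected graph, possibly with multiple edges, with vertex set $X\cup X^{-1}$ and an edge joining $x$ and $y$ for each distinct word of the form $xy^{-1}u$ in $\tilde R$, where the edges corresponding to the inverse pair $xy^{-1}u$, $yx^{-1}u^{-1}$ are identified. Special presentations: let $m\geq 2$, $k\geq 3$, $\nu\geq 1$. A finite presentation $\langle X\mid R\rangle$ is $(m,k,\nu)$-special if (a) its star graph has exactly $\nu$ connected components, which are pairwise isomorphic, each a connected bipartite graph of diameter $m$ and girth $2m$ in which each vertex has degree at least $3$; (b) each relator has length $k$; (c) if $m=2$ then $k\geq 4$. Girth is the length of a shortest closed path in which consecutive edges are never equal (so a pair of parallel edges gives such a path of length $2$). *)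

theory Defs
  imports "HOL-Library.Multiset" "HOL-Library.Extended_Nat" "HOL-Number_Theory.Cong"
begin

text \<open>
  The letter \<open>(x, True)\<close> stands for the generator \<open>x\<close> and \<open>(x, False)\<close> for its inverse.
  Elements of the free group on \<open>X\<close> are represented by words over \<open>X\<close>; two words represent
  the same element iff they are related by \<open>free_eq\<close>.
\<close>

type_synonym 'a letter = "'a \<times> bool"
type_synonym 'a fword = "'a letter list"

definition inv_letter :: "'a letter \<Rightarrow> 'a letter" where
  "inv_letter a = (fst a, \<not> snd a)"

definition inv_word :: "'a fword \<Rightarrow> 'a fword" where
  "inv_word w = rev (map inv_letter w)"

definition words_over :: "'a set \<Rightarrow> 'a fword set" where
  "words_over X = lists (X \<times> UNIV)"

definition cancels_step :: "'a fword \<Rightarrow> 'a fword \<Rightarrow> bool" where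
  "cancels_step v w \<longleftrightarrow> (\<exists>p a q. v = p @ [a, inv_letter a] @ q \<and> w = p @ q)"

definition free_eq :: "'a fword \<Rightarrow> 'a fword \<Rightarrow> bool" where
  "free_eq = equivclp cancels_step"

definition freely_conjugate :: "'a set \<Rightarrow> 'a fword \<Rightarrow> 'a fword \<Rightarrow> bool" where
  "freely_conjugate X r s \<longleftrightarrow> (\<exists>g\<in>words_over X. free_eq r (g @ s @ inv_word g))"

definition proper_power :: "'a set \<Rightarrow> 'a fword \<Rightarrow> bool" where
  "proper_power X w \<longleftrightarrow>
     (\<exists>v\<in>words_over X. \<exists>t\<ge>2. free_eq w (concat (replicate t v)))"

text \<open>
  Adjacency is cyclic, so this says both that the word is freely reduced and that its
  first and last letters do not cancel.
\<close>

definition cyclically_reduced :: "'a fword \<Rightarrow> bool" where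
  "cyclically_reduced w \<longleftrightarrow>
     (\<forall>i<length w. w ! (Suc i mod length w) \<noteq> inv_letter (w ! i))"

definition positive_word :: "'a fword \<Rightarrow> bool" where
  "positive_word w \<longleftrightarrow> (\<forall>a\<in>set w. snd a)"

lemma positive_word_cyclically_reduced:
  assumes "positive_word w"
  shows "cyclically_reduced w"
  unfolding cyclically_reduced_def
proof (intro allI impI)
  fix i assume i: "i < length w"
  then have "Suc i mod length w < length w" by (intro mod_less_divisor) linarith
  with i have "snd (w ! i)" "snd (w ! (Suc i mod length w))"
    using assms by (auto simp: positive_word_def)
  then show "w ! (Suc i mod length w) \<noteq> inv_letter (w ! i)"
    by (auto simp: inv_letter_def)
qed

record 'a presentation =
  gens :: "'a set"
  rels :: "'a fword set"

definition freely_redundant :: "'a presentation \<Rightarrow> 'a fword \<Rightarrow> bool" where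
  "freely_redundant P r \<longleftrightarrow>
     free_eq r [] \<or>
     (\<exists>s\<in>rels P. \<not> free_eq r s \<and>
        (freely_conjugate (gens P) r s \<or> freely_conjugate (gens P) r (inv_word s)))"

definition non_redundant :: "'a presentation \<Rightarrow> bool" where
  "non_redundant P \<longleftrightarrow> (\<forall>r\<in>rels P. \<not> freely_redundant P r)"

text \<open>\<open>ends\<close> maps an edge to the set of its (one or two) endpoints.\<close>

record ('v, 'e) mgraph =
  verts :: "'v set"
  edges :: "'e set"
  ends :: "'e \<Rightarrow> 'v set"

primrec walk :: "('v, 'e) mgraph \<Rightarrow> 'v \<Rightarrow> 'e list \<Rightarrow> 'v \<Rightarrow> bool" where
  "walk G u [] v \<longleftrightarrow> u \<in> verts G \<and> u = v"
| "walk G u (e # es) v \<longleftrightarrow>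
     u \<in> verts G \<and> e \<in> edges G \<and> (\<exists>u'. ends G e = {u, u'} \<and> walk G u' es v)"

definition reachable :: "('v, 'e) mgraph \<Rightarrow> 'v \<Rightarrow> 'v \<Rightarrow> bool" where
  "reachable G u v \<longleftrightarrow> (\<exists>es. walk G u es v)"

definition connected_graph :: "('v, 'e) mgraph \<Rightarrow> bool" where
  "connected_graph G \<longleftrightarrow>
     verts G \<noteq> {} \<and> (\<forall>u\<in>verts G. \<forall>v\<in>verts G. reachable G u v)"

definition induced :: "('v, 'e) mgraph \<Rightarrow> 'v set \<Rightarrow> ('v, 'e) mgraph" where
  "induced G U = \<lparr>verts = U, edges = {e \<in> edges G. ends G e \<subseteq> U}, ends = ends G\<rparr>"

definition graph_components :: "('v, 'e) mgraph \<Rightarrow> ('v, 'e) mgraph set" where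
  "graph_components G = (\<lambda>u. induced G {v. reachable G u v}) ` verts G"

definition graph_iso :: "('v, 'e) mgraph \<Rightarrow> ('w, 'f) mgraph \<Rightarrow> bool" where
  "graph_iso G H \<longleftrightarrow>
     (\<exists>f g. bij_betw f (verts G) (verts H) \<and> bij_betw g (edges G) (edges H) \<and>
            (\<forall>e\<in>edges G. ends H (g e) = f ` ends G e))"

definition bipartite_graph :: "('v, 'e) mgraph \<Rightarrow> bool" where
  "bipartite_graph G \<longleftrightarrow>
     (\<exists>A B. A \<union> B = verts G \<and> A \<inter> B = {} \<and>
            (\<forall>e\<in>edges G. \<exists>a\<in>A. \<exists>b\<in>B. ends G e = {a, b}))"

text \<open>A loop contributes two to the degree of its endpoint.\<close>

definition graph_degree :: "('v, 'e) mgraph \<Rightarrow> 'v \<Rightarrow> nat" where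
  "graph_degree G v =
     card {e \<in> edges G. v \<in> ends G e} + card {e \<in> edges G. ends G e = {v}}"

definition graph_dist :: "('v, 'e) mgraph \<Rightarrow> 'v \<Rightarrow> 'v \<Rightarrow> enat" where
  "graph_dist G u v = (INF es\<in>{es. walk G u es v}. enat (length es))"

definition graph_diameter :: "('v, 'e) mgraph \<Rightarrow> enat" where
  "graph_diameter G = (SUP u\<in>verts G. SUP v\<in>verts G. graph_dist G u v)"

definition graph_girth :: "('v, 'e) mgraph \<Rightarrow> enat" where
  "graph_girth G =
     (INF es\<in>{es. es \<noteq> [] \<and> distinct_adj es \<and> (\<exists>v. walk G v es v)}. enat (length es))"

definition sym_closure :: "'a fword set \<Rightarrow> 'a fword set" where
  "sym_closure R = {rotate i r | i r. r \<in> R \<union> inv_word ` R}"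

text \<open>
  \<open>flip_word\<close> sends the word \<open>x y\<^sup>-\<^sup>1 u\<close> to \<open>y x\<^sup>-\<^sup>1 u\<^sup>-\<^sup>1\<close>.  An edge of the star graph is an
  orbit of this involution on the words of length at least two in \<open>sym_closure R\<close>, and both
  words of the orbit give the same pair of endpoints \<open>x\<close>, \<open>y\<close>.
\<close>

fun flip_word :: "'a fword \<Rightarrow> 'a fword" where
  "flip_word (a # b # u) = inv_letter b # inv_letter a # inv_word u"
| "flip_word w = w"

definition star_graph :: "'a presentation \<Rightarrow> ('a letter, 'a fword set) mgraph" where
  "star_graph P =
     \<lparr>verts = gens P \<times> UNIV,
      edges = {{w, flip_word w} | w. w \<in> sym_closure (rels P) \<and> length w \<ge> 2},
      ends = (\<lambda>e. \<Union>w\<in>e. {w ! 0, inv_letter (w ! 1)})\<rparr>"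

definition special :: "nat \<Rightarrow> nat \<Rightarrow> nat \<Rightarrow> 'a presentation \<Rightarrow> bool" where
  "special m k \<nu> P \<longleftrightarrow>
     m \<ge> 2 \<and> k \<ge> 3 \<and> \<nu> \<ge> 1 \<and>
     finite (gens P) \<and> finite (rels P) \<and> rels P \<subseteq> words_over (gens P) \<and>
     (\<forall>r\<in>rels P. cyclically_reduced r) \<and>
     finite (graph_components (star_graph P)) \<and>
     card (graph_components (star_graph P)) = \<nu> \<and>
     (\<forall>C\<in>graph_components (star_graph P).
        \<forall>D\<in>graph_components (star_graph P). graph_iso C D) \<and>
     (\<forall>C\<in>graph_components (star_graph P).
        connected_graph C \<and> bipartite_graph C \<and>
        graph_diameter C = enat m \<and> graph_girth C = enat (2 * m) \<and>
        (\<forall>v\<in>verts C. graph_degree C v \<ge> 3)) \<and>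
     (\<forall>r\<in>rels P. length r = k) \<and>
     (m = 2 \<longrightarrow> k \<ge> 4)"

text \<open>The generator \<open>x\<^sub>i\<close> is represented by \<open>i < n\<close>.\<close>

definition shift :: "nat \<Rightarrow> nat fword \<Rightarrow> nat fword" where
  "shift n w = map (\<lambda>(i, e). (Suc i mod n, e)) w"

definition cyclic_presentation :: "nat \<Rightarrow> nat fword \<Rightarrow> nat presentation" where
  "cyclic_presentation n w =
     \<lparr>gens = {..<n}, rels = (\<lambda>j. (shift n ^^ j) w) ` {..<n}\<rparr>"

definition irreducible_cyclic :: "nat \<Rightarrow> nat fword \<Rightarrow> bool" where
  "irreducible_cyclic n w \<longleftrightarrow> Gcd (insert n (fst ` set w)) = 1"

text \<open>One entry for each of the \<open>length w\<close> positions of a length-two cyclic subword.\<close>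

definition subword_diffs :: "nat \<Rightarrow> nat fword \<Rightarrow> int multiset" where
  "subword_diffs n w =
     image_mset
       (\<lambda>j. (int (fst (w ! (Suc j mod length w))) - int (fst (w ! j))) mod int n)
       (mset_set {..<length w})"

text \<open>
  The multiset of all \<open>d\<^sub>i - d\<^sub>j\<close> with \<open>i \<noteq> j\<close>: repeated entries \<open>d\<^sub>i = d\<^sub>j\<close> with \<open>i \<noteq> j\<close>
  contribute differences equal to zero.
\<close>

definition differences :: "int multiset \<Rightarrow> int multiset" where
  "differences D = (\<Sum>d\<in>#D. image_mset (\<lambda>d'. d - d') (D - {#d#}))"

definition perfect_difference_set :: "nat \<Rightarrow> int multiset \<Rightarrow> bool" where
  "perfect_difference_set k D \<longleftrightarrow>
     size D = k \<and>
     (\<forall>r\<in>{1..int (k^2 - k)}.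
        count (image_mset (\<lambda>d. d mod int (k^2 - k + 1)) (differences D)) r = 1)"

end

theory Submission
  imports Defs
begin

text \<open>
  For positive \<open>w\<close> with successive subscript differences \<open>q\<^sub>0, \<dots>, q\<^sub>k\<^sub>-\<^sub>1\<close>, the star graph is the
  bipartite graph joining \<open>x\<^sub>c\<close> to the inverse of \<open>x\<close> with subscript \<open>c + q\<^sub>j\<close>, for all \<open>c\<close> modulo \<open>n\<close>
  and all \<open>j\<close>; non-redundancy and the absence of a root of \<open>w\<close> make these \<open>n k\<close> edges distinct.
  Girth \<open>6\<close> says that the differences \<open>q\<^sub>i - q\<^sub>j\<close> (\<open>i \<noteq> j\<close>) are distinct and nonzero modulo \<open>n\<close>, and
  diameter \<open>3\<close> says that together with \<open>0\<close> they fill the subgroup of those \<open>h\<close> for which \<open>x\<^sub>h\<close> lies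
  in the component of \<open>x\<^sub>0\<close>.  That subgroup has order \<open>N = k\<^sup>2 - k + 1\<close>, and its index is the number of
  components, so \<open>n = \<nu> N\<close> and all \<open>q\<^sub>j\<close> agree modulo \<open>\<nu>\<close>.  The differences add up to \<open>0\<close>
  modulo \<open>n\<close>, so \<open>\<nu>\<close> divides \<open>k q\<^sub>0\<close>, and irreducibility makes \<open>q\<^sub>0\<close> prime to \<open>\<nu>\<close>; hence \<open>\<nu>\<close> divides \<open>k\<close>
  and is prime to \<open>N\<close>, which lets one pass between residues modulo \<open>n\<close> and modulo \<open>N\<close>.
\<close>

section \<open>Walks, distance and girth in multigraphs\<close>

lemma walk_append:
  "walk G u (es @ fs) v \<longleftrightarrow> (\<exists>x. walk G u es x \<and> walk G x fs v)"
proof (induction es arbitrary: u)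
  case Nil
  show ?case by (cases fs) auto
qed auto

lemma walk_verts: "walk G u es v \<Longrightarrow> u \<in> verts G \<and> v \<in> verts G"
  by (induction es arbitrary: u) auto

lemma walk_rev: "walk G u es v \<Longrightarrow> walk G v (rev es) u"
proof (induction es arbitrary: u)
  case (Cons e es)
  then obtain u' where u': "u \<in> verts G" "e \<in> edges G" "ends G e = {u, u'}" "walk G u' es v"
    by auto
  then have "walk G v (rev es) u'" "walk G u' [e] u"
    using Cons.IH walk_verts[OF u'(4)] by (auto simp: insert_commute)
  then show ?case by (auto simp: walk_append simp del: walk.simps)
qed auto

lemma reachable_refl: "u \<in> verts G \<Longrightarrow> reachable G u u"
  unfolding reachable_def by (metis walk.simps(1))

lemma reachable_sym: "reachable G u v \<Longrightarrow> reachable G v u"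
  unfolding reachable_def using walk_rev by metis

lemma reachable_trans: "reachable G u v \<Longrightarrow> reachable G v x \<Longrightarrow> reachable G u x"
  unfolding reachable_def using walk_append by metis

lemma reachable_verts: "reachable G u v \<Longrightarrow> u \<in> verts G \<and> v \<in> verts G"
  unfolding reachable_def using walk_verts by metis

lemma reachable_class_eq:
  assumes "reachable G u v"
  shows "{x. reachable G u x} = {x. reachable G v x}"
  using assms reachable_trans[OF assms] reachable_trans[OF reachable_sym[OF assms]] by auto

text \<open>A walk that starts in a component never leaves it, so passing to the induced subgraph
  loses no walk from there. Diameter and girth of components thus become statements about walks in
  \<open>G\<close>.\<close>

lemma walk_induced_component:
  "walk (induced G {x. reachable G u x}) y es z \<longleftrightarrow> reachable G u y \<and> walk G y es z"
proof (induction es arbitrary: y)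
  case Nil
  show ?case using reachable_verts[of G u y] by (auto simp: induced_def)
next
  case (Cons e es)
  have step: "reachable G u x"
    if "reachable G u y" "e \<in> edges G" "ends G e = {y, x}" "x \<in> verts G" for x
  proof -
    have "walk G y [e] x" using that reachable_verts[of G u y] by auto
    with that(1) show ?thesis using reachable_trans unfolding reachable_def by metis
  qed
  show ?case
  proof
    assume "walk (induced G {x. reachable G u x}) y (e # es) z"
    then show "reachable G u y \<and> walk G y (e # es) z"
      using Cons.IH reachable_verts[of G u y] by (force simp: induced_def)
  next
    assume *: "reachable G u y \<and> walk G y (e # es) z"
    then obtain x where x: "e \<in> edges G" "ends G e = {y, x}" "walk G x es z" by auto
    then have "reachable G u x" using * step walk_verts by metis
    with * x show "walk (induced G {x. reachable G u x}) y (e # es) z"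
      using Cons.IH[of x] by (auto simp: induced_def)
  qed
qed

section \<open>Distance, diameter and girth in terms of walks\<close>

lemma graph_dist_le_iff:
  "graph_dist G u v \<le> enat m \<longleftrightarrow> (\<exists>es. walk G u es v \<and> length es \<le> m)"
proof
  assume le: "graph_dist G u v \<le> enat m"
  have "{es. walk G u es v} \<noteq> {}"
  proof
    assume "{es. walk G u es v} = {}"
    then show False using le unfolding graph_dist_def by (simp add: top_enat_def)
  qed
  \<comment> \<open>The infimum of a nonempty subset of \<open>enat\<close> is its least element, so
    it is the length of an actual walk.\<close>
  then have "graph_dist G u v \<in> (\<lambda>es. enat (length es)) ` {es. walk G u es v}"
    unfolding graph_dist_def unfolding Inf_enat_def using LeastI_ex[of "\<lambda>x. x \<in> (\<lambda>es. enat (length es)) ` {es. walk G u es v}"] by auto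
  with le show "\<exists>es. walk G u es v \<and> length es \<le> m" by auto
next
  assume "\<exists>es. walk G u es v \<and> length es \<le> m"
  then show "graph_dist G u v \<le> enat m"
    unfolding graph_dist_def by (auto intro: INF_lower2)
qed

lemma graph_diameter_eqI:
  assumes "\<And>u v. u \<in> verts G \<Longrightarrow> v \<in> verts G \<Longrightarrow> \<exists>es. walk G u es v \<and> length es \<le> m"
    and "u \<in> verts G" "v \<in> verts G" "\<And>es. walk G u es v \<Longrightarrow> m \<le> length es"
  shows "graph_diameter G = enat m"
proof (rule antisym)
  show "graph_diameter G \<le> enat m"
    unfolding graph_diameter_def
    by (intro SUP_least) (use assms(1) in \<open>simp add: graph_dist_le_iff\<close>)
  have "enat m \<le> graph_dist G u v"
    unfolding graph_dist_def using assms(4) by (intro INF_greatest) auto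
  also have "\<dots> \<le> graph_diameter G"
    unfolding graph_diameter_def using assms(2,3) by (intro SUP_upper2[of u] SUP_upper) auto
  finally show "enat m \<le> graph_diameter G" .
qed

lemma graph_diameter_walk:
  assumes "graph_diameter G = enat m" "u \<in> verts G" "v \<in> verts G"
  obtains es where "walk G u es v" "length es \<le> m"
proof -
  have "graph_dist G u v \<le> graph_diameter G"
    unfolding graph_diameter_def using assms(2,3) by (intro SUP_upper2[of u] SUP_upper) auto
  then show ?thesis using assms(1) that by (auto simp: graph_dist_le_iff)
qed

lemma graph_girth_eqI:
  assumes "\<And>v es. walk G v es v \<Longrightarrow> es \<noteq> [] \<Longrightarrow> distinct_adj es \<Longrightarrow> m \<le> length es"
    and "walk G v es v" "es \<noteq> []" "distinct_adj es" "length es = m"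
  shows "graph_girth G = enat m"
  unfolding graph_girth_def using assms
  by (intro antisym INF_greatest INF_lower2[of es]) (simp_all, blast+)

lemma graph_girth_le:
  assumes "graph_girth G = enat m" "walk G v es v" "es \<noteq> []" "distinct_adj es"
  shows "m \<le> length es"
proof -
  have "graph_girth G \<le> enat (length es)"
    unfolding graph_girth_def using assms by (intro INF_lower) auto
  then show ?thesis using assms(1) by simp
qed

text \<open>\<open>H\<close> is a nonzero subgroup of the integers. The remainder of an element of
  \<open>H\<close> modulo the least positive element \<open>p\<close> lies in \<open>H\<close> again
  and is smaller than \<open>p\<close>, so it is 0.\<close>

lemma int_subgroup_principal:
  fixes H :: "int set"
  assumes "m \<in> H" "m > 0" and diff: "\<And>x y. x \<in> H \<Longrightarrow> y \<in> H \<Longrightarrow> x - y \<in> H"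
  obtains d where "d > 0" "H = {h. d dvd h}"
proof -
  define p where "p = (LEAST p::nat. p > 0 \<and> int p \<in> H)"
  have ex: "nat m > 0 \<and> int (nat m) \<in> H" using assms by simp
  then have p: "p > 0" "int p \<in> H"
    unfolding p_def using LeastI[of "\<lambda>p. p > 0 \<and> int p \<in> H"] by blast+
  have least: "p \<le> r" if "r > 0" "int r \<in> H" for r
    unfolding p_def using that by (intro Least_le) auto
  have zero: "0 \<in> H" using diff[OF p(2) p(2)] by simp
  have neg: "- x \<in> H" if "x \<in> H" for x using diff[OF zero that] by simp
  have mult_nat: "int p * int c \<in> H" for c
  proof (induction c)
    case (Suc c)
    then show ?case using diff[OF Suc neg[OF p(2)]] by (simp add: algebra_simps)
  qed (simp add: zero)
  have mult: "int p * c \<in> H" for c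
  proof (cases "c \<ge> 0")
    case True
    then show ?thesis using mult_nat[of "nat c"] by simp
  next
    case False
    then show ?thesis using neg[OF mult_nat[of "nat (- c)"]] by simp
  qed
  have "int p dvd h" if "h \<in> H" for h
  proof -
    have "h mod int p = h - int p * (h div int p)" by (simp add: minus_mult_div_eq_mod)
    then have mem: "h mod int p \<in> H" using diff[OF that mult] by simp
    have bounds: "0 \<le> h mod int p" "h mod int p < int p" using p by simp_all
    have "h mod int p = 0"
    proof (rule ccontr)
      assume "h mod int p \<noteq> 0"
      with bounds have "p \<le> nat (h mod int p)" using least mem by auto
      with bounds show False by linarith
    qed
    then show ?thesis by auto
  qed
  with mult have "H = {h. int p dvd h}" by (auto elim!: dvdE)
  then show ?thesis using that[of "int p"] p(1) by simp
qed

section \<open>Perfect difference sets\<close>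

text \<open>Pairs of positions, not of values: repeated entries of a multiset stay distinguishable
  and contribute zero differences.\<close>

definition off_diagonal :: "nat \<Rightarrow> (nat \<times> nat) set" where
  "off_diagonal k = {(i, j). i < k \<and> j < k \<and> i \<noteq> j}"

lemma finite_off_diagonal [simp]: "finite (off_diagonal k)"
  by (rule finite_subset[of _ "{..<k} \<times> {..<k}"]) (auto simp: off_diagonal_def)

lemma off_diagonal_Sigma: "off_diagonal k = (SIGMA i:{..<k}. {..<k} - {i})"
  by (auto simp: off_diagonal_def)

lemma card_off_diagonal [simp]: "card (off_diagonal k) = k\<^sup>2 - k"
  by (simp add: off_diagonal_Sigma power2_eq_square algebra_simps)

lemma sum_image_mset_Sigma:
  assumes "finite A" "\<And>i. i \<in> A \<Longrightarrow> finite (B i)"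
  shows "(\<Sum>i\<in>A. image_mset (f i) (mset_set (B i))) = image_mset (case_prod f) (mset_set (Sigma A B))"
  using assms
proof (induction A rule: finite_induct)
  case (insert i A)
  have "Sigma (insert i A) B = Pair i ` B i \<union> Sigma A B" by auto
  moreover have "Pair i ` B i \<inter> Sigma A B = {}" using insert.hyps by auto
  ultimately have "mset_set (Sigma (insert i A) B) = mset_set (Pair i ` B i) + mset_set (Sigma A B)"
    using insert by (simp add: mset_set_Union)
  also have "mset_set (Pair i ` B i) = image_mset (Pair i) (mset_set (B i))"
    by (intro image_mset_mset_set [symmetric]) (auto simp: inj_on_def)
  finally show ?case using insert by (simp add: image_mset.compositionality comp_def)
qed simp

text \<open>Removing one copy of the value \<open>q i\<close> leaves the values at the indices other
  than \<open>i\<close>, whichever index that copy came from.\<close>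

lemma differences_image_mset:
  "differences (image_mset q (mset_set {..<k})) =
     image_mset (\<lambda>(i, j). q i - q j) (mset_set (off_diagonal k))"
proof -
  let ?D = "image_mset q (mset_set {..<k})"
  have "differences ?D = (\<Sum>i\<in>{..<k}. image_mset (\<lambda>d'. q i - d') (?D - {#q i#}))"
    by (simp add: differences_def image_mset.compositionality comp_def sum_unfold_sum_mset)
  also have "\<dots> = (\<Sum>i\<in>{..<k}. image_mset (\<lambda>j. q i - q j) (mset_set ({..<k} - {i})))"
  proof (rule sum.cong)
    fix i assume "i \<in> {..<k}"
    then have "mset_set {..<k} = add_mset i (mset_set ({..<k} - {i}))"
      by (intro mset_set.remove) auto
    then have "?D - {#q i#} = image_mset q (mset_set ({..<k} - {i}))" by simp
    then show "image_mset (\<lambda>d'. q i - d') (?D - {#q i#}) =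
        image_mset (\<lambda>j. q i - q j) (mset_set ({..<k} - {i}))"
      by (simp add: image_mset.compositionality comp_def)
  qed simp
  finally show ?thesis by (simp add: sum_image_mset_Sigma off_diagonal_Sigma)
qed

text \<open>There are as many pairs of distinct positions as nonzero residues. Hitting every nonzero
  residue therefore forces injectivity and leaves no pair for the residue 0, whose multiplicity the
  definition does not mention.\<close>

lemma perfect_difference_set_iff_bij:
  "perfect_difference_set k (image_mset q (mset_set {..<k})) \<longleftrightarrow>
     bij_betw (\<lambda>(i, j). (q i - q j) mod int (k\<^sup>2 - k + 1)) (off_diagonal k) {1..int (k\<^sup>2 - k)}"
proof -
  define \<phi> where "\<phi> = (\<lambda>(i, j). (q i - q j) mod int (k\<^sup>2 - k + 1))"
  let ?S = "off_diagonal k" and ?R = "{1..int (k\<^sup>2 - k)}"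
  have "image_mset (\<lambda>d. d mod int (k\<^sup>2 - k + 1)) (differences (image_mset q (mset_set {..<k}))) =
      image_mset \<phi> (mset_set ?S)"
    unfolding differences_image_mset
    unfolding image_mset.compositionality by (intro image_mset_cong) (auto simp: \<phi>_def)
  moreover have "count (image_mset \<phi> (mset_set ?S)) r = card {x \<in> ?S. \<phi> x = r}" for r
  proof -
    have "count (image_mset \<phi> (mset_set ?S)) r = (\<Sum>x\<in>{x \<in> ?S. \<phi> x = r}. 1)"
      unfolding count_image_mset' by (intro sum.cong) auto
    then show ?thesis by simp
  qed
  ultimately have pds: "perfect_difference_set k (image_mset q (mset_set {..<k})) \<longleftrightarrow>
      (\<forall>r\<in>?R. card {x \<in> ?S. \<phi> x = r} = 1)"
    by (simp add: perfect_difference_set_def)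
  also have "\<dots> \<longleftrightarrow> bij_betw \<phi> ?S ?R"
  proof
    assume *: "\<forall>r\<in>?R. card {x \<in> ?S. \<phi> x = r} = 1"
    have "?R \<subseteq> \<phi> ` ?S"
    proof
      fix r assume "r \<in> ?R"
      then have "{x \<in> ?S. \<phi> x = r} \<noteq> {}" using * by (metis card.empty zero_neq_one)
      then show "r \<in> \<phi> ` ?S" by auto
    qed
    moreover have "card ?R = card ?S" by simp
    moreover have "card (\<phi> ` ?S) \<le> card ?S" by (rule card_image_le) simp
    ultimately have "\<phi> ` ?S = ?R"
      by (metis card_seteq finite_imageI finite_off_diagonal)
    then show "bij_betw \<phi> ?S ?R"
      unfolding bij_betw_def using eq_card_imp_inj_on[of ?S \<phi>] by simp
  next
    assume bij: "bij_betw \<phi> ?S ?R"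
    show "\<forall>r\<in>?R. card {x \<in> ?S. \<phi> x = r} = 1"
    proof
      fix r assume "r \<in> ?R"
      then obtain x where "x \<in> ?S" "\<phi> x = r" using bij by (metis bij_betw_imp_surj_on imageE)
      then have "{x \<in> ?S. \<phi> x = r} = {x}" using bij by (auto simp: bij_betw_def inj_on_def)
      then show "card {x \<in> ?S. \<phi> x = r} = 1" by simp
    qed
  qed
  finally show ?thesis unfolding \<phi>_def .
qed

text \<open>Since \<open>k\<^sup>2 - k + 1 = k * (k - 1) + 1\<close>, this number is 1 modulo every
  divisor of \<open>k\<close>.\<close>

lemma coprime_order_modulus:
  assumes "\<nu> dvd k"
  shows "coprime (int \<nu>) (int (k\<^sup>2 - k + 1))"
proof -
  have "\<nu> dvd k\<^sup>2 - k" using assms by (simp add: power2_eq_square dvd_diff_nat)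
  then have "coprime \<nu> (k\<^sup>2 - k + 1)"
    by (intro coprimeI) (metis dvd_add_right_iff dvd_trans)
  then show ?thesis by (simp only: coprime_int_iff)
qed

section \<open>Bipartite graphs with a cyclic symmetry\<close>

text \<open>Subscripts are arbitrary integers read modulo \<open>n\<close>, so that differences can
  be added and subtracted freely.\<close>

definition vtx :: "nat \<Rightarrow> bool \<Rightarrow> int \<Rightarrow> nat letter" where
  "vtx n s c = (nat (c mod int n), s)"

text \<open>The labels \<open>E c j\<close> keep parallel edges apart: if \<open>q i = q j\<close>
  for distinct \<open>i\<close> and \<open>j\<close>, then \<open>E c i\<close> and
  \<open>E c j\<close> have the same ends but are different edges.\<close>

locale bicirculant =
  fixes G :: "(nat letter, 'e) mgraph" and E :: "int \<Rightarrow> nat \<Rightarrow> 'e"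
    and q :: "nat \<Rightarrow> int" and n k :: nat
  assumes n_pos: "n > 0" and k_ge: "k \<ge> 3"
    and verts_G: "verts G = {..<n} \<times> UNIV"
    and edges_G: "edges G = {E c j | c j. j < k}"
    and E_eq_iff: "\<And>c c' j j'. j < k \<Longrightarrow> j' < k \<Longrightarrow>
      E c j = E c' j' \<longleftrightarrow> [c = c'] (mod int n) \<and> j = j'"
    and ends_E: "\<And>c j. j < k \<Longrightarrow> ends G (E c j) = {vtx n True c, vtx n False (c + q j)}"
begin

abbreviation "pos \<equiv> vtx n True"
abbreviation "neg \<equiv> vtx n False"

lemma vtx_eq_iff [simp]: "vtx n s c = vtx n s' c' \<longleftrightarrow> s = s' \<and> [c = c'] (mod int n)"
  using n_pos by (auto simp: vtx_def cong_def eq_nat_nat_iff)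

lemma vtx_in_verts [simp]: "vtx n s c \<in> verts G"
  using n_pos by (simp add: vtx_def verts_G nat_less_iff)

lemma verts_cases:
  assumes "v \<in> verts G"
  obtains (pos) c where "v = pos c" | (neg) c where "v = neg c"
proof -
  obtain i s where "v = (i, s)" "i < n" using assms by (auto simp: verts_G)
  then have "v = pos (int i) \<or> v = neg (int i)" by (simp add: vtx_def)
  then show ?thesis using that by blast
qed

text \<open>Walks become alternating sums: an edge of index \<open>j\<close> adds \<open>q j\<close>
  when it leaves a positive vertex and, in \<open>walk_neg_Cons\<close>, subtracts
  \<open>q j\<close> when it leaves a negative one. Where a walk ends is then a congruence modulo
  \<open>n\<close>.\<close>

lemma walk_pos_Cons:
  "walk G (pos c) (e # es) v \<longleftrightarrow> (\<exists>j<k. e = E c j \<and> walk G (neg (c + q j)) es v)"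
proof
  assume "walk G (pos c) (e # es) v"
  then obtain u c' j where *: "e = E c' j" "j < k" "ends G e = {pos c, u}" "walk G u es v"
    by (auto simp: edges_G)
  then have "{pos c', neg (c' + q j)} = {pos c, u}" by (simp add: ends_E)
  then have "pos c' = pos c" "u = neg (c' + q j)" by (auto simp: doubleton_eq_iff)
  moreover from this have "neg (c' + q j) = neg (c + q j)" by (simp add: cong_add)
  ultimately have "u = neg (c + q j)" "E c' j = E c j" using *(2) by (auto simp: E_eq_iff)
  with * show "\<exists>j<k. e = E c j \<and> walk G (neg (c + q j)) es v" by auto
next
  assume "\<exists>j<k. e = E c j \<and> walk G (neg (c + q j)) es v"
  then show "walk G (pos c) (e # es) v" by (auto simp del: split_paired_Ex simp: ends_E edges_G)
qed

lemma walk_neg_Cons: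
  "walk G (neg c) (e # es) v \<longleftrightarrow> (\<exists>j<k. e = E (c - q j) j \<and> walk G (pos (c - q j)) es v)"
proof
  assume "walk G (neg c) (e # es) v"
  then obtain u c' j where *: "e = E c' j" "j < k" "ends G e = {neg c, u}" "walk G u es v"
    by (auto simp: edges_G)
  then have "{pos c', neg (c' + q j)} = {neg c, u}" by (simp add: ends_E)
  then have eq: "neg (c' + q j) = neg c" "u = pos c'" by (auto simp: doubleton_eq_iff)
  then have "[c' + q j - q j = c - q j] (mod int n)" by (intro cong_diff) auto
  then have "pos c' = pos (c - q j)" "E c' j = E (c - q j) j"
    using *(2) by (auto simp: E_eq_iff)
  with * eq show "\<exists>j<k. e = E (c - q j) j \<and> walk G (pos (c - q j)) es v" by auto
next
  assume "\<exists>j<k. e = E (c - q j) j \<and> walk G (pos (c - q j)) es v"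
  then show "walk G (neg c) (e # es) v"
    by (auto simp del: split_paired_Ex simp: ends_E edges_G insert_commute)
qed

lemma walk_Nil_vtx: "walk G (vtx n s c) [] v \<longleftrightarrow> v = vtx n s c"
  by auto

lemmas walk_simps = walk_Nil_vtx walk_pos_Cons walk_neg_Cons

text \<open>Every negative vertex has a positive neighbour, so positive vertices suffice to
  represent all components.\<close>

lemma component_neg:
  obtains c' where "{v. reachable G (neg c) v} = {v. reachable G (pos c') v}"
proof -
  have "walk G (neg c) [E (c - q 0) 0] (pos (c - q 0))"
    unfolding walk_simps using k_ge by (intro exI[of _ 0]) auto
  then have "reachable G (neg c) (pos (c - q 0))" unfolding reachable_def by blast
  then have "{v. reachable G (neg c) v} = {v. reachable G (pos (c - q 0)) v}"
    by (rule reachable_class_eq)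
  then show ?thesis using that by blast
qed

definition component :: "int \<Rightarrow> (nat letter, 'e) mgraph" where
  "component a = induced G {v. reachable G (pos a) v}"

lemma components_eq: "graph_components G = range component"
proof -
  have "induced G {v. reachable G u v} \<in> range component" if "u \<in> verts G" for u
    using that
  proof (cases rule: verts_cases)
    case (neg c)
    obtain c' where "{v. reachable G (neg c) v} = {v. reachable G (pos c') v}"
      by (rule component_neg)
    then show ?thesis using neg by (auto simp: component_def)
  qed (auto simp: component_def)
  then show ?thesis
    unfolding graph_components_def by (auto simp: component_def)
qed

lemma component_eq_iff: "component a = component b \<longleftrightarrow> reachable G (pos a) (pos b)"
proof
  assume "component a = component b"
  then have "{v. reachable G (pos a) v} = {v. reachable G (pos b) v}"
    by (simp add: component_def induced_def)
  then show "reachable G (pos a) (pos b)" using reachable_refl[of "pos b" G] by auto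
next
  assume "reachable G (pos a) (pos b)"
  then have "{v. reachable G (pos a) v} = {v. reachable G (pos b) v}"
    by (rule reachable_class_eq)
  then show "component a = component b" by (simp add: component_def)
qed

text \<open>The integers from 0 to \<open>d - 1\<close> represent the residue classes modulo
  \<open>d\<close>, one for each component.\<close>

lemma card_components:
  assumes "d > 0" and reach: "\<And>a b. reachable G (pos a) (pos b) \<longleftrightarrow> d dvd b - a"
  shows "finite (graph_components G)" "card (graph_components G) = nat d"
proof -
  have mod: "component a = component (a mod d)" for a
  proof -
    have "a mod d - a = - (d * (a div d))" by (simp add: minus_mult_div_eq_mod [symmetric])
    then show ?thesis by (simp add: component_eq_iff reach)
  qed
  have eq: "graph_components G = component ` {0..<d}"
    unfolding components_eq
  proof
    show "range component \<subseteq> component ` {0..<d}"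
    proof
      fix C assume "C \<in> range component"
      then obtain a where "C = component (a mod d)" using mod by auto
      then show "C \<in> component ` {0..<d}" using \<open>d > 0\<close> by auto
    qed
  qed auto
  have "inj_on component {0..<d}"
  proof (rule inj_onI)
    fix a b assume ab: "a \<in> {0..<d}" "b \<in> {0..<d}" "component a = component b"
    then have "d dvd b - a" by (simp add: component_eq_iff reach)
    then have "b mod d = a mod d" by (simp add: mod_eq_dvd_iff)
    with ab show "a = b" by simp
  qed
  with eq show "finite (graph_components G)" "card (graph_components G) = nat d"
    by (simp_all add: card_image)
qed

section \<open>From girth 6 and diameter 3 to differences\<close>

declare walk.simps(2) [simp del]

lemma E_eq_same [simp]: "i < k \<Longrightarrow> j < k \<Longrightarrow> E c i = E c j \<longleftrightarrow> i = j"
  by (simp add: E_eq_iff)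

lemma walk_pos_E [simp]:
  assumes "j < k"
  shows "walk G (pos c) (E c j # es) v \<longleftrightarrow> walk G (neg (c + q j)) es v"
  unfolding walk_pos_Cons using E_eq_same assms by blast

lemma walk_neg_E [simp]:
  assumes "j < k" "c' = c - q j"
  shows "walk G (neg c) (E c' j # es) v \<longleftrightarrow> walk G (pos c') es v"
proof -
  have "i = j" if "i < k" "E c' j = E (c - q i) i" for i
    using that assms(1) by (simp add: E_eq_iff)
  then show ?thesis unfolding walk_neg_Cons using assms by blast
qed

text \<open>The two clauses exclude reduced closed walks of length 2 and of length 4. With
  generators as points and inverses as lines, two distinct points share at most one line.\<close>

definition distinct_differences :: bool where
  "distinct_differences \<longleftrightarrow>
     (\<forall>i<k. \<forall>j<k. [q i = q j] (mod int n) \<longrightarrow> i = j) \<and>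
     (\<forall>i<k. \<forall>j<k. \<forall>i'<k. \<forall>j'<k. i \<noteq> j \<longrightarrow> i' \<noteq> j' \<longrightarrow>
        [q i - q j = q i' - q j'] (mod int n) \<longrightarrow> i = i' \<and> j = j')"

text \<open>A violation of the first clause closes up a reduced walk of length 2, and one of the
  second clause a reduced walk of length 4.\<close>

lemma distinct_differences_closed_walks:
  assumes girth: "\<And>c es. walk G (pos c) es (pos c) \<Longrightarrow> es \<noteq> [] \<Longrightarrow> distinct_adj es \<Longrightarrow> 6 \<le> length es"
  shows distinct_differences
proof -
  have inj: "i = j" if "i < k" "j < k" "[q i = q j] (mod int n)" for i j
  proof (rule ccontr)
    assume "i \<noteq> j"
    have "[0 + q i - q j = 0] (mod int n)"
      using cong_diff[OF that(3) cong_refl[of "q j"]] by simp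
    then have "walk G (pos 0) [E 0 i, E (0 + q i - q j) j] (pos 0)"
      using that(1,2) by (simp add: cong_sym)
    moreover have "distinct_adj [E 0 i, E (0 + q i - q j) j]"
      using \<open>i \<noteq> j\<close> that by (simp add: E_eq_iff)
    ultimately show False using girth by fastforce
  qed
  have "i = i' \<and> j = j'"
    if lt: "i < k" "j < k" "i' < k" "j' < k" and ne: "i \<noteq> j" "i' \<noteq> j'"
      and eq: "[q i - q j = q i' - q j'] (mod int n)" for i j i' j'
  \<comment> \<open>For \<open>j = j'\<close> the second and third edges of the closed walk used
    below would coincide; this case reduces to injectivity of \<open>q\<close> modulo
    \<open>n\<close>.\<close>
  proof (cases "j = j'")
    case True
    then have "[q i = q i'] (mod int n)"
      using cong_add[OF eq cong_refl[of "q j"]] by simp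
    with inj lt True show ?thesis by blast
  next
    case False
    let ?es = "[E 0 i, E (0 + q i - q j) j, E (0 + q i - q j) j', E (0 + q i - q j + q j' - q i') i']"
    have "[0 + q i - q j + q j' - q i' = 0] (mod int n)"
      using cong_diff[OF eq cong_refl[of "q i' - q j'"]] by (simp add: algebra_simps)
    then have "walk G (pos 0) ?es (pos 0)"
      using lt by (simp add: cong_sym)
    moreover have "distinct_adj ?es"
      using ne False lt by (simp add: E_eq_iff)
    ultimately show ?thesis using girth by fastforce
  qed
  with inj show ?thesis unfolding distinct_differences_def by blast
qed

text \<open>The pairs of distinct indices correspond bijectively to the nonzero multiples of
  \<open>d\<close> modulo \<open>n\<close>, and there are \<open>m - 1\<close> of these.\<close>

lemma card_multiples:
  assumes "distinct_differences" "d > 0" "int n = d * m"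
    and H: "\<And>h. d dvd h \<longleftrightarrow> (\<exists>i<k. \<exists>j<k. [h = q i - q j] (mod int n))"
  shows "m = int (k\<^sup>2 - k + 1)"
proof -
  have m: "m > 0" using assms(2,3) n_pos zero_less_mult_pos[of d m] by simp
  define f where "f = (\<lambda>(i, j). (q i - q j) mod int n)"
  have "inj_on f (off_diagonal k)"
  proof (rule inj_onI)
    fix x y assume xy: "x \<in> off_diagonal k" "y \<in> off_diagonal k" "f x = f y"
    obtain i j i' j' where eq: "x = (i, j)" "y = (i', j')" by (cases x, cases y)
    have "[q i - q j = q i' - q j'] (mod int n)" using xy(3) by (simp add: eq f_def cong_def)
    then show "x = y"
      using xy(1,2) assms(1) unfolding distinct_differences_def off_diagonal_def eq by blast
  qed
  moreover have "f ` off_diagonal k = (\<lambda>x. d * x) ` {1..<m}"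
  proof (intro equalityI subsetI)
    fix h assume "h \<in> f ` off_diagonal k"
    then obtain i j where ij: "i < k" "j < k" "i \<noteq> j" "h = (q i - q j) mod int n"
      by (auto simp: f_def off_diagonal_def)
    then have "d dvd h" unfolding H by (auto simp: cong_def)
    then obtain x where x: "h = d * x" by (elim dvdE)
    have "h \<noteq> 0"
    proof
      assume "h = 0"
      then have "[q i = q j] (mod int n)"
        using ij(4) by (simp add: cong_iff_dvd_diff mod_eq_0_iff_dvd)
      with ij assms(1) show False unfolding distinct_differences_def by blast
    qed
    moreover have "0 \<le> h" "h < d * m" using ij(4) n_pos assms(3) by simp_all
    ultimately have "0 < x" "x < m" using x \<open>d > 0\<close>
      by (auto simp: zero_le_mult_iff less_le)
    then show "h \<in> (\<lambda>x. d * x) ` {1..<m}" using x by auto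
  next
    fix h assume "h \<in> (\<lambda>x. d * x) ` {1..<m}"
    then obtain x where x: "h = d * x" "x \<in> {1..<m}" by (rule imageE)
    then have "1 \<le> x" "x < m" by simp_all
    note x = x(1) this
    have h: "0 < h" unfolding x(1) using x(2) assms(2) by simp
    have h': "h < int n" unfolding x(1) assms(3) using x(3) assms(2) by simp
    from x have "d dvd h" by simp
    then obtain i j where ij: "i < k" "j < k" "[h = q i - q j] (mod int n)" using H by auto
    have "h = f (i, j)" using ij(3) h h' by (simp add: f_def cong_def)
    moreover have "i \<noteq> j" using calculation h by (auto simp: f_def)
    ultimately show "h \<in> f ` off_diagonal k" using ij by (auto simp: off_diagonal_def)
  qed
  ultimately have "k\<^sup>2 - k = card ((\<lambda>x. d * x) ` {1..<m})"
    using card_image[of f "off_diagonal k"] by simp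
  also have "\<dots> = nat (m - 1)"
    using \<open>d > 0\<close> by (subst card_image) (auto simp: inj_on_def)
  finally show ?thesis using m by simp
qed

lemma components_imp_differences:
  assumes card: "card (graph_components G) = \<nu>"
    and comp: "\<And>C. C \<in> graph_components G \<Longrightarrow> graph_diameter C = enat 3 \<and> graph_girth C = enat 6"
  shows distinct_differences "n = \<nu> * (k\<^sup>2 - k + 1)"
    "\<And>i j. i < k \<Longrightarrow> j < k \<Longrightarrow> [q i = q j] (mod int \<nu>)"
proof -
  have comps: "component a \<in> graph_components G" for a by (simp add: components_eq)
  show dd: distinct_differences
  proof (rule distinct_differences_closed_walks)
    fix c es assume *: "walk G (pos c) es (pos c)" "es \<noteq> []" "distinct_adj es"
    have "walk (component c) (pos c) es (pos c)"
      using * by (simp add: component_def walk_induced_component reachable_refl)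
    with * show "6 \<le> length es" using graph_girth_le[of "component c" 6 "pos c" es] comp[OF comps[of c]] by simp
  qed
  \<comment> \<open>Walks between two positive vertices have even length, so a bound of 3 on the
    distance is a bound of 2. Being reachable then means differing by some
    \<open>q i - q j\<close>.\<close>
  have reach: "reachable G (pos a) (pos b) \<longleftrightarrow>
      (\<exists>i<k. \<exists>j<k. [b - a = q i - q j] (mod int n))" for a b
  proof
    assume r: "reachable G (pos a) (pos b)"
    have "graph_diameter (component a) = enat 3" using comp[OF comps[of a]] by simp
    then obtain es where "walk (component a) (pos a) es (pos b)" and len: "length es \<le> 3"
    proof (rule graph_diameter_walk)
      show "pos a \<in> verts (component a)" "pos b \<in> verts (component a)"
        using r by (simp_all add: component_def induced_def reachable_refl)
    qed
    then have w: "walk G (pos a) es (pos b)"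
      by (simp add: component_def walk_induced_component)
    consider "es = []" | e where "es = [e]" | e f where "es = [e, f]" | e f g where "es = [e, f, g]"
      using len by (cases es; cases "tl es"; cases "tl (tl es)"; cases "tl (tl (tl es))") auto
    then show "\<exists>i<k. \<exists>j<k. [b - a = q i - q j] (mod int n)"
    proof cases
      case 1
      \<comment> \<open>The difference 0 is represented by a pair of equal indices.\<close>
      with w have "[b - a = q 0 - q 0] (mod int n)"
        unfolding 1 walk_simps by (simp add: cong_iff_dvd_diff)
      then show ?thesis using k_ge by (intro exI[of _ 0] conjI) auto
    next
      case (2 e)
      with w show ?thesis unfolding 2 walk_simps by auto
    next
      case (3 e f)
      with w obtain i j where "i < k" "j < k" "[b = a + q i - q j] (mod int n)"
        unfolding 3 walk_simps by auto
      then show ?thesis by (auto simp: cong_iff_dvd_diff algebra_simps)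
    next
      case (4 e f g)
      with w show ?thesis unfolding 4 walk_simps by auto
    qed
  next
    assume "\<exists>i<k. \<exists>j<k. [b - a = q i - q j] (mod int n)"
    then obtain i j where ij: "i < k" "j < k" "[b = a + q i - q j] (mod int n)"
      by (auto simp: cong_iff_dvd_diff algebra_simps)
    then have "walk G (pos a) [E a i, E (a + q i - q j) j] (pos b)"
      by (simp add: cong_sym)
    then show "reachable G (pos a) (pos b)" unfolding reachable_def by blast
  qed
  \<comment> \<open>By \<open>reach\<close>, reachability depends only on the difference of
    subscripts. As it is an equivalence relation, \<open>H\<close> is a subgroup; its positive
    generator \<open>d\<close> is the number of components.\<close>
  define H where "H = {h. reachable G (pos 0) (pos h)}"
  have H: "h \<in> H \<longleftrightarrow> (\<exists>i<k. \<exists>j<k. [h = q i - q j] (mod int n))" for h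
    unfolding H_def by (simp add: reach)
  have "int n \<in> H"
    unfolding H using k_ge by (intro exI[of _ 0] conjI) (auto simp: cong_iff_dvd_diff)
  moreover have "int n > 0" using n_pos by simp
  moreover have "x - y \<in> H" if "x \<in> H" "y \<in> H" for x y
  proof -
    have "reachable G (pos y) (pos x)"
      using that unfolding H_def by (blast intro: reachable_trans reachable_sym)
    then show ?thesis by (simp add: reach H)
  qed
  ultimately obtain d where d: "d > 0" "H = {h. d dvd h}"
    by (rule int_subgroup_principal)
  then have reach': "reachable G (pos a) (pos b) \<longleftrightarrow> d dvd b - a" for a b
    using H[of "b - a"] by (simp add: reach)
  then have "\<nu> = nat d" using card_components(2)[OF d(1)] card by simp
  then have \<nu>: "d = int \<nu>" using d(1) by simp
  from \<open>int n \<in> H\<close> d obtain m where m: "int n = d * m" by auto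
  have "m = int (k\<^sup>2 - k + 1)"
    by (rule card_multiples[OF dd d(1) m]) (use H d(2) in auto)
  then have "int n = int (\<nu> * (k\<^sup>2 - k + 1))" using m \<nu> by (simp only: of_nat_mult)
  then show "n = \<nu> * (k\<^sup>2 - k + 1)" by (simp only: of_nat_eq_iff)
  show "[q i = q j] (mod int \<nu>)" if "i < k" "j < k" for i j
  proof -
    have "q i - q j \<in> H"
      unfolding H using that by (intro exI[of _ i] exI[of _ j] conjI) simp_all
    then show ?thesis using d(2) \<nu> by (simp add: cong_iff_dvd_diff)
  qed
qed

end

text \<open>The setting of the converse. \<open>dd\<close> gives uniqueness and
  \<open>diff_ex\<close> existence of a line through two distinct points of a component, so each
  component is the incidence graph of a projective plane of order \<open>k - 1\<close>.\<close>

locale projective_bicirculant = bicirculant +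
  fixes \<nu> :: nat
  assumes \<nu>_dvd: "\<nu> dvd n"
    and q_cong: "\<And>i j. i < k \<Longrightarrow> j < k \<Longrightarrow> [q i = q j] (mod int \<nu>)"
    and dd: distinct_differences
    and diff_ex: "\<And>c. int \<nu> dvd c \<Longrightarrow> \<exists>i<k. \<exists>j<k. [c = q i - q j] (mod int n)"
begin

declare split_paired_All [simp del] split_paired_Ex [simp del]

lemma \<nu>_pos: "\<nu> > 0" using \<nu>_dvd n_pos by (auto intro: dvd_pos_nat)

lemma q_inj: "i < k \<Longrightarrow> j < k \<Longrightarrow> int n dvd q i - q j \<longleftrightarrow> i = j"
  using dd unfolding distinct_differences_def cong_iff_dvd_diff by (metis diff_self dvd_0_right)

lemma q_diff_inj:
  assumes "i < k" "j < k" "i' < k" "j' < k" "i \<noteq> j" "i' \<noteq> j'"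
    and "int n dvd (q i - q j) - (q i' - q j')"
  shows "i = i' \<and> j = j'"
proof -
  have "[q i - q j = q i' - q j'] (mod int n)" using assms(7) by (simp add: cong_iff_dvd_diff)
  then show ?thesis using assms(1-6) dd unfolding distinct_differences_def by blast
qed

lemma cong_mod_\<nu>: "[a = b] (mod int n) \<Longrightarrow> [a = b] (mod int \<nu>)"
  using \<nu>_dvd by (meson cong_dvd_modulus int_dvd_int_iff)

text \<open>This turns out to be the vertex set of the component of \<open>pos a\<close>. Any
  \<open>q j\<close> with \<open>j < k\<close> could stand for \<open>q 0\<close>, as all of them
  agree modulo \<nu>.\<close>

definition U :: "int \<Rightarrow> nat letter set" where
  "U a = {pos c | c. int \<nu> dvd c - a} \<union> {neg c | c. int \<nu> dvd c - q 0 - a}"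

text \<open>The representative \<open>c\<close> modulo \<open>n\<close> does not matter because
  \<nu> divides \<open>n\<close>.\<close>

lemma pos_in_U [simp]: "pos c \<in> U a \<longleftrightarrow> int \<nu> dvd c - a"
proof
  assume "pos c \<in> U a"
  then obtain c' where c': "[c = c'] (mod int n)" "int \<nu> dvd c' - a" by (auto simp: U_def)
  then have "int \<nu> dvd (c - c') + (c' - a)"
    using cong_mod_\<nu>[OF c'(1)] unfolding cong_iff_dvd_diff by (rule_tac dvd_add) auto
  then show "int \<nu> dvd c - a" by simp
next
  assume "int \<nu> dvd c - a"
  then show "pos c \<in> U a" unfolding U_def by blast
qed

lemma neg_in_U [simp]: "neg c \<in> U a \<longleftrightarrow> int \<nu> dvd c - q 0 - a"
proof
  assume "neg c \<in> U a"
  then obtain c' where c': "[c = c'] (mod int n)" "int \<nu> dvd c' - q 0 - a" by (auto simp: U_def)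
  then have "int \<nu> dvd (c - c') + (c' - q 0 - a)"
    using cong_mod_\<nu>[OF c'(1)] unfolding cong_iff_dvd_diff by (rule_tac dvd_add) auto
  then show "int \<nu> dvd c - q 0 - a" by (simp add: algebra_simps)
next
  assume "int \<nu> dvd c - q 0 - a"
  then show "neg c \<in> U a" unfolding U_def by blast
qed

lemma dvd_add_q: "j < k \<Longrightarrow> int \<nu> dvd c + q j - q 0 - a \<longleftrightarrow> int \<nu> dvd c - a"
  using q_cong[of j 0] k_ge dvd_add_right_iff[of "int \<nu>" "q j - q 0" "c - a"]
  by (simp add: cong_iff_dvd_diff algebra_simps)

lemma dvd_diff_q: "j < k \<Longrightarrow> int \<nu> dvd c - q 0 - a \<Longrightarrow> int \<nu> dvd c - q j - a"
  using q_cong[of 0 j] k_ge dvd_add[of "int \<nu>" "q 0 - q j" "c - q 0 - a"]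
  by (simp add: cong_iff_dvd_diff algebra_simps)

lemma U_cases:
  assumes "v \<in> U a"
  obtains (pos) c where "v = pos c" "int \<nu> dvd c - a"
    | (neg) c where "v = neg c" "int \<nu> dvd c - q 0 - a"
  using assms unfolding U_def by auto

text \<open>Modulo \<nu> every step adds or subtracts the same number \<open>q 0\<close>, so no walk
  leaves the residue classes that make up \<open>U a\<close>.\<close>

lemma walk_U: "walk G u es v \<Longrightarrow> u \<in> U a \<Longrightarrow> v \<in> U a"
proof (induction es arbitrary: u)
  case (Cons e es)
  from Cons.prems(2) show ?case
  proof (cases rule: U_cases)
    case (pos c)
    then obtain j where j: "j < k" "walk G (neg (c + q j)) es v"
      using Cons.prems(1) unfolding pos(1) walk_simps by auto
    then show ?thesis using Cons.IH pos(2) by (simp add: dvd_add_q)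
  next
    case (neg c)
    then obtain j where j: "j < k" "walk G (pos (c - q j)) es v"
      using Cons.prems(1) unfolding neg(1) walk_simps by auto
    then show ?thesis using Cons.IH neg(2) by (simp add: dvd_diff_q)
  qed
qed auto

lemma walk_pos_pos:
  assumes "int \<nu> dvd b - a"
  obtains es where "walk G (pos a) es (pos b)" "length es = 2"
proof -
  obtain i j where ij: "i < k" "j < k" "[b - a = q i - q j] (mod int n)"
    using diff_ex assms by blast
  then have "[b = a + q i - q j] (mod int n)" by (simp add: cong_iff_dvd_diff algebra_simps)
  with ij have "walk G (pos a) [E a i, E (a + q i - q j) j] (pos b)"
    by (simp add: cong_sym)
  then show ?thesis using that by fastforce
qed

text \<open>From a negative vertex the subtraction comes first, so the two indices of the difference
  are used in the opposite order.\<close>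

lemma walk_neg_neg:
  assumes "int \<nu> dvd b - a"
  obtains es where "walk G (neg a) es (neg b)" "length es = 2"
proof -
  obtain i j where ij: "i < k" "j < k" "[b - a = q i - q j] (mod int n)"
    using diff_ex assms by blast
  then have "[b = a - q j + q i] (mod int n)" by (simp add: cong_iff_dvd_diff algebra_simps)
  with ij have "walk G (neg a) [E (a - q j) j, E (a - q j) i] (neg b)"
    by (simp add: cong_sym)
  then show ?thesis using that by fastforce
qed

lemma walk_pos_neg:
  assumes "int \<nu> dvd b - q 0 - a"
  obtains es where "walk G (pos a) es (neg b)" "length es = 3"
proof -
  \<comment> \<open>\<open>pos (b - q 0)\<close> is a neighbour of \<open>neg b\<close> and
    congruent to \<open>a\<close> modulo \<nu>: two steps lead to it and a third one to
    \<open>neg b\<close>.\<close>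
  obtain es where es: "walk G (pos a) es (pos (b - q 0))" "length es = 2"
    using walk_pos_pos[of "b - q 0" a] assms by auto
  have "walk G (pos (b - q 0)) [E (b - q 0) 0] (neg b)"
    using k_ge by simp
  then have "walk G (pos a) (es @ [E (b - q 0) 0]) (neg b)"
    unfolding walk_append using es(1) by blast
  then show ?thesis using that es(2) by fastforce
qed

lemma walk_within_U:
  assumes "u \<in> U a" "v \<in> U a"
  shows "\<exists>es. walk G u es v \<and> length es \<le> 3"
  using assms(1)
proof (cases rule: U_cases)
  case u: (pos c)
  from assms(2) show ?thesis
  proof (cases rule: U_cases)
    case v: (pos b)
    have "int \<nu> dvd b - c" using dvd_diff[OF v(2) u(2)] by simp
    then obtain es where "walk G u es v" "length es = 2" using walk_pos_pos u v by metis
    then show ?thesis by (intro exI[of _ es]) simp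
  next
    case v: (neg b)
    have "int \<nu> dvd b - q 0 - c" using dvd_diff[OF v(2) u(2)] by (simp add: algebra_simps)
    then obtain es where "walk G u es v" "length es = 3" using walk_pos_neg u v by metis
    then show ?thesis by (intro exI[of _ es]) simp
  qed
next
  case u: (neg c)
  from assms(2) show ?thesis
  proof (cases rule: U_cases)
    case v: (pos b)
    have "int \<nu> dvd c - q 0 - b" using dvd_diff[OF u(2) v(2)] by (simp add: algebra_simps)
    then obtain es where "walk G v es u" "length es = 3" using walk_pos_neg u v by metis
    then show ?thesis using walk_rev[of G v es u] by (intro exI[of _ "rev es"]) simp
  next
    case v: (neg b)
    have "int \<nu> dvd b - c" using dvd_diff[OF v(2) u(2)] by simp
    then obtain es where "walk G u es v" "length es = 2" using walk_neg_neg u v by metis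
    then show ?thesis by (intro exI[of _ es]) simp
  qed
qed

lemma reachable_iff_U:
  assumes "u \<in> U a"
  shows "reachable G u v \<longleftrightarrow> v \<in> U a"
proof
  assume "reachable G u v"
  then show "v \<in> U a" using walk_U[OF _ assms] unfolding reachable_def by blast
next
  assume "v \<in> U a"
  then show "reachable G u v" using walk_within_U[OF assms] unfolding reachable_def by blast
qed

lemma reachable_pos: "{v. reachable G (pos a) v} = U a"
  by (simp add: reachable_iff_U[of "pos a" a])

lemma components_card: "finite (graph_components G)" "card (graph_components G) = \<nu>"
proof -
  have "reachable G (pos a) (pos b) \<longleftrightarrow> int \<nu> dvd b - a" for a b
    by (simp add: reachable_iff_U[of "pos a" a])
  then show "finite (graph_components G)" "card (graph_components G) = \<nu>"
    using card_components[of "int \<nu>"] \<nu>_pos by simp_all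
qed

lemma walk_component: "walk (component a) u es v \<longleftrightarrow> u \<in> U a \<and> walk G u es v"
  unfolding component_def walk_induced_component by (simp add: reachable_iff_U[of "pos a" a])

lemma verts_component: "verts (component a) = U a"
  by (simp add: component_def induced_def reachable_pos)

lemma ends_component: "ends (component a) = ends G"
  by (simp add: component_def induced_def)

lemma edges_component: "e \<in> edges (component a) \<longleftrightarrow> (\<exists>c j. e = E c j \<and> j < k \<and> int \<nu> dvd c - a)"
proof -
  have *: "ends G (E c j) \<subseteq> U a \<longleftrightarrow> int \<nu> dvd c - a" if "j < k" for c j
    using that by (simp add: ends_E dvd_add_q)
  have "e \<in> edges (component a) \<longleftrightarrow> (\<exists>c j. e = E c j \<and> j < k) \<and> ends G e \<subseteq> U a"
    by (simp add: component_def induced_def reachable_pos edges_G)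
  with * show ?thesis by metis
qed

lemma E_in_component: "j < k \<Longrightarrow> int \<nu> dvd c - a \<Longrightarrow> E c j \<in> edges (component a)"
  unfolding edges_component by metis

section \<open>Shape of a single component\<close>

lemma component_connected: "connected_graph (component a)"
  unfolding connected_graph_def
proof (intro conjI ballI)
  have "pos a \<in> U a" by simp
  then show "verts (component a) \<noteq> {}" unfolding verts_component by (rule_tac notI) simp
next
  fix u v assume "u \<in> verts (component a)" "v \<in> verts (component a)"
  then show "reachable (component a) u v"
    using walk_within_U[of u a v] by (auto simp: reachable_def walk_component verts_component)
qed

lemma component_bipartite: "bipartite_graph (component a)"
  unfolding bipartite_graph_def
proof (rule exI[of _ "{v \<in> U a. snd v}"], rule exI[of _ "{v \<in> U a. \<not> snd v}"], intro conjI ballI)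
  fix e assume "e \<in> edges (component a)"
  then obtain c j where e: "e = E c j" "j < k" "int \<nu> dvd c - a" by (auto simp: edges_component)
  then have "pos c \<in> {v \<in> U a. snd v}" "neg (c + q j) \<in> {v \<in> U a. \<not> snd v}"
    "ends (component a) e = {pos c, neg (c + q j)}"
    by (simp_all add: dvd_add_q ends_component ends_E) (simp_all add: vtx_def)
  then show "\<exists>x\<in>{v \<in> U a. snd v}. \<exists>y\<in>{v \<in> U a. \<not> snd v}. ends (component a) e = {x, y}"
    by blast
qed (auto simp: verts_component)

lemma component_diameter: "graph_diameter (component a) = enat 3"
proof (rule graph_diameter_eqI)
  fix u v assume "u \<in> verts (component a)" "v \<in> verts (component a)"
  then show "\<exists>es. walk (component a) u es v \<and> length es \<le> 3"
    using walk_within_U[of u a v] by (auto simp: walk_component verts_component)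
next
  \<comment> \<open>The vertex \<open>neg (a + q 0 + q 1 - q 2)\<close> is not adjacent to
    \<open>pos a\<close>: an edge of index \<open>j\<close> would make \<open>q 1 - q 2\<close>
    congruent to \<open>q j - q 0\<close>. For \<open>j = 0\<close> this contradicts injectivity of
    \<open>q\<close>, otherwise distinctness of the differences.\<close>
  have "int \<nu> dvd q 1 - q 2" using q_cong[of 1 2] k_ge by (simp add: cong_iff_dvd_diff)
  then show "pos a \<in> verts (component a)" "neg (a + q 0 + q 1 - q 2) \<in> verts (component a)"
    by (simp_all add: verts_component)
  fix es assume "walk (component a) (pos a) es (neg (a + q 0 + q 1 - q 2))"
  then have w: "walk G (pos a) es (neg (a + q 0 + q 1 - q 2))" by (simp add: walk_component)
  show "3 \<le> length es"
  proof (rule ccontr)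
    assume "\<not> 3 \<le> length es"
    then consider "es = []" | e where "es = [e]" | e f where "es = [e, f]"
      by (cases es; cases "tl es"; cases "tl (tl es)") auto
    then show False
    proof cases
      case 1
      with w show False unfolding 1 walk_simps by auto
    next
      case (2 e)
      with w obtain j where j: "j < k" "[a + q 0 + q 1 - q 2 = a + q j] (mod int n)"
        unfolding 2 walk_simps by auto
      then have dvd: "int n dvd q 1 - q 2 - (q j - q 0)"
        by (simp add: cong_iff_dvd_diff algebra_simps)
      have "j \<noteq> 0"
      proof
        assume "j = 0"
        with dvd have "int n dvd q 1 - q 2" by simp
        then show False using q_inj[of 1 2] k_ge by simp
      qed
      then show False using q_diff_inj[of 1 2 j 0] dvd j k_ge by simp
    next
      case (3 e f)
      with w show False unfolding 3 walk_simps by auto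
    qed
  qed
qed

text \<open>Signs alternate along a walk, so closed walks have even length. Length 2 contradicts
  injectivity of \<open>q\<close> modulo \<open>n\<close>, length 4 the distinctness of the
  differences.\<close>

lemma closed_walk_length:
  assumes "walk G v es v" "es \<noteq> []" "distinct_adj es"
  shows "6 \<le> length es"
proof (rule ccontr)
  assume "\<not> 6 \<le> length es"
  moreover have "length es \<noteq> 0" using assms(2) by simp
  ultimately have "length es = 1 \<or> length es = 2 \<or> length es = 3 \<or> length es = 4 \<or> length es = 5"
    by linarith
  then consider e1 where "es = [e1]" | e1 e2 where "es = [e1, e2]"
    | e1 e2 e3 where "es = [e1, e2, e3]" | e1 e2 e3 e4 where "es = [e1, e2, e3, e4]"
    | e1 e2 e3 e4 e5 where "es = [e1, e2, e3, e4, e5]"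
    by (auto simp: numeral_eq_Suc length_Suc_conv)
  note cases = this
  have "v \<in> verts G" using walk_verts[OF assms(1)] by simp
  then show False
  proof (cases rule: verts_cases)
    case (pos c)
    from cases assms(1) show False unfolding pos
    proof cases
      case (2 e1 e2)
      with assms(1) obtain i j where ij: "i < k" "j < k" "e1 = E c i" "e2 = E (c + q i - q j) j"
        "[c = c + q i - q j] (mod int n)"
        unfolding pos 2 walk_simps by auto
      then have "int n dvd q i - q j"
        by (simp add: cong_iff_dvd_diff dvd_diff_commute algebra_simps)
      then show False using ij q_inj assms(3) 2 by (simp add: E_eq_iff)
    next
      case (4 e1 e2 e3 e4)
      with assms(1) obtain i j i' j' where ij: "i < k" "j < k" "i' < k" "j' < k"
        "e1 = E c i" "e2 = E (c + q i - q j) j" "e3 = E (c + q i - q j) i'"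
        "e4 = E (c + q i - q j + q i' - q j') j'"
        "[c = c + q i - q j + q i' - q j'] (mod int n)"
        unfolding pos 4 walk_simps by auto
      then have dvd: "int n dvd q i - q j - (q j' - q i')"
        using dvd_diff_commute[of "int n" c "c + q i - q j + q i' - q j'"] by (simp add: cong_iff_dvd_diff algebra_simps)
      \<comment> \<open>The second and third edges meet in a positive vertex, so being different
        they have different indices. Equality of the two differences would force
        \<open>j = i'\<close>.\<close>
      have ne: "j \<noteq> i'" using assms(3) ij by (auto simp: 4)
      show False
      proof (cases "i = j \<or> i' = j'")
        case True
        \<comment> \<open>\<open>i = j\<close> would make the first two edges equal, and
          \<open>i' = j'\<close> the last two.\<close>
        then show ?thesis
          using assms(3) ij unfolding 4 by (auto simp: E_eq_iff cong_iff_dvd_diff)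
      next
        case False
        then show ?thesis using q_diff_inj[of i j j' i'] dvd ij ne by auto
      qed
    qed (auto simp: walk_simps)
  next
    case (neg c)
    from cases assms(1) show False unfolding neg
    proof cases
      case (2 e1 e2)
      with assms(1) obtain i j where ij: "i < k" "j < k" "e1 = E (c - q i) i" "e2 = E (c - q i) j"
        "[c = c - q i + q j] (mod int n)"
        unfolding neg 2 walk_simps by auto
      then have "int n dvd q i - q j"
        by (simp add: cong_iff_dvd_diff algebra_simps)
      then show False using ij q_inj assms(3) 2 by (simp add: E_eq_iff)
    next
      case (4 e1 e2 e3 e4)
      with assms(1) obtain i j i' j' where ij: "i < k" "j < k" "i' < k" "j' < k"
        "e1 = E (c - q i) i" "e2 = E (c - q i) j" "e3 = E (c - q i + q j - q i') i'"
        "e4 = E (c - q i + q j - q i') j'"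
        "[c = c - q i + q j - q i' + q j'] (mod int n)"
        unfolding neg 4 walk_simps by auto
      then have dvd: "int n dvd q i - q j - (q j' - q i')"
        by (simp add: cong_iff_dvd_diff algebra_simps)
      show False
        using q_diff_inj[of i j j' i'] dvd ij assms(3) unfolding 4
        by (auto simp: E_eq_iff cong_iff_dvd_diff)
    qed (auto simp: walk_simps)
  qed
qed

text \<open>The hexagon closes up because the steps \<open>+q 0 - q 1 + q 2 - q 0 + q 1 - q 2\<close> cancel.\<close>

lemma component_girth: "graph_girth (component a) = enat 6"
proof (rule graph_girth_eqI)
  fix v es assume "walk (component a) v es v" "es \<noteq> []" "distinct_adj es"
  then show "6 \<le> length es" using closed_walk_length walk_component by blast
next
  let ?es = "[E a 0, E (a + q 0 - q 1) 1, E (a + q 0 - q 1) 2, E (a + q 0 - q 1 + q 2 - q 0) 0,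
    E (a + q 0 - q 1 + q 2 - q 0) 1, E (a + q 0 - q 1 + q 2 - q 0 + q 1 - q 2) 2]"
  have lt: "0 < k" "1 < k" "2 < k" using k_ge by auto
  have "walk G (pos a) ?es (pos a)"
    using lt by simp
  then show "walk (component a) (pos a) ?es (pos a)" by (simp add: walk_component)
  show "distinct_adj ?es" using lt by (simp add: E_eq_iff)
qed auto

text \<open>Each vertex lies on an edge of every index \<open>j < k\<close>, hence on at least
  \<open>k\<close> edges.\<close>

lemma component_degree:
  assumes "v \<in> verts (component a)"
  shows "graph_degree (component a) v \<ge> 3"
proof -
  let ?I = "{e \<in> edges (component a). v \<in> ends (component a) e}"
  \<comment> \<open>Finiteness has to come first: \<open>card\<close> is 0 on infinite sets, so an
    inclusion alone gives no lower bound on the degree.\<close>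
  have "?I \<subseteq> (\<lambda>(c, j). E (int c) j) ` ({..<n} \<times> {..<k})"
  proof
    fix e assume "e \<in> ?I"
    then obtain c j where e: "e = E c j" "j < k" unfolding edges_component by blast
    then have "e = E (int (nat (c mod int n))) j" using n_pos by (simp add: E_eq_iff)
    moreover have "nat (c mod int n) < n" using n_pos by (simp add: nat_less_iff)
    ultimately show "e \<in> (\<lambda>(c, j). E (int c) j) ` ({..<n} \<times> {..<k})"
      using e(2) by (intro image_eqI[of _ _ "(nat (c mod int n), j)"]) auto
  qed
  then have fin: "finite ?I" by (rule finite_subset) simp
  have "\<exists>c. \<forall>j<k. E (c j) j \<in> ?I"
    using assms unfolding verts_component
  proof (cases rule: U_cases)
    case (pos c)
    then have "E c j \<in> ?I" if "j < k" for j
      using that by (simp add: E_in_component ends_component ends_E)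
    then show ?thesis by (intro exI[of _ "\<lambda>_. c"]) simp
  next
    case (neg c)
    have "E (c - q j) j \<in> ?I" if "j < k" for j
    proof (intro CollectI conjI)
      show "E (c - q j) j \<in> edges (component a)"
        by (rule E_in_component[OF that dvd_diff_q[OF that neg(2)]])
      show "v \<in> ends (component a) (E (c - q j) j)"
        using that by (simp add: neg(1) ends_component ends_E)
    qed
    then show ?thesis by (intro exI[of _ "\<lambda>j. c - q j"]) simp
  qed
  then obtain c where "\<forall>j<k. E (c j) j \<in> ?I" ..
  then have "(\<lambda>j. E (c j) j) ` {..<k} \<subseteq> ?I" by (simp add: image_subset_iff)
  moreover have "inj_on (\<lambda>j. E (c j) j) {..<k}" by (auto simp: inj_on_def E_eq_iff)
  ultimately have "card {..<k} \<le> card ?I" using fin by (intro card_inj_on_le)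
  then show ?thesis using k_ge by (simp add: graph_degree_def)
qed

section \<open>Translations between components\<close>

definition translate_vertex :: "int \<Rightarrow> nat letter \<Rightarrow> nat letter" where
  "translate_vertex t v = vtx n (snd v) (int (fst v) + t)"

lemma translate_vertex_vtx [simp]: "translate_vertex t (vtx n s c) = vtx n s (c + t)"
  using n_pos by (auto simp: translate_vertex_def vtx_def mod_add_left_eq)

lemma translate_vertex_U: "v \<in> U a \<Longrightarrow> translate_vertex (b - a) v \<in> U b"
  by (erule U_cases) (simp_all add: algebra_simps)

lemma translate_vertex_inverse: "v \<in> U a \<Longrightarrow> translate_vertex t (translate_vertex (- t) v) = v"
  by (erule U_cases) simp_all

text \<open>Edges have an abstract type, so the coordinates of an edge are recovered by choice. The
  first is determined only modulo \<open>n\<close>, which by \<open>E_eq_iff\<close> does not affect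
  the result.\<close>

definition translate_edge :: "int \<Rightarrow> 'a \<Rightarrow> 'a" where
  "translate_edge t e =
     (let p = SOME p. e = E (fst p) (snd p) \<and> snd p < k in E (fst p + t) (snd p))"

lemma translate_edge_E [simp]:
  assumes "j < k"
  shows "translate_edge t (E c j) = E (c + t) j"
proof -
  define P where "P = (\<lambda>p. E c j = E (fst p) (snd p) \<and> snd p < k)"
  define p where "p = (SOME p. P p)"
  have "P (c, j)" using assms by (simp add: P_def)
  then have "P p" unfolding p_def by (rule someI)
  then have "E c j = E (fst p) (snd p)" "snd p < k" by (simp_all add: P_def)
  then have "[c = fst p] (mod int n)" "snd p = j" using assms by (simp_all add: E_eq_iff)
  then have "E (fst p + t) (snd p) = E (c + t) j"
    using assms by (simp add: E_eq_iff cong_add cong_sym)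
  then show ?thesis unfolding translate_edge_def p_def P_def by simp
qed

lemma translate_edge_edges:
  assumes "e \<in> edges (component a)"
  shows "translate_edge (b - a) e \<in> edges (component b)"
proof -
  obtain c j where e: "e = E c j" "j < k" "int \<nu> dvd c - a"
    using assms by (auto simp: edges_component)
  then have "translate_edge (b - a) e = E (c + (b - a)) j" "int \<nu> dvd c + (b - a) - b"
    by (simp_all add: algebra_simps)
  with e(2) show ?thesis by (simp add: E_in_component)
qed

lemma translate_edge_inverse:
  assumes "e \<in> edges (component a)"
  shows "translate_edge t (translate_edge (- t) e) = e"
proof -
  obtain c j where "e = E c j" "j < k" using assms by (auto simp: edges_component)
  then show ?thesis by simp
qed

lemma components_iso: "graph_iso (component a) (component b)"
  unfolding graph_iso_def
proof (intro exI conjI)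
  let ?t = "b - a"
  show "bij_betw (translate_vertex ?t) (verts (component a)) (verts (component b))"
    using translate_vertex_U[of _ a b] translate_vertex_U[of _ b a]
      translate_vertex_inverse[of _ b ?t] translate_vertex_inverse[of _ a "- ?t"]
    by (intro bij_betw_byWitness[where f' = "translate_vertex (- ?t)"])
      (simp_all add: verts_component image_subset_iff)
  show "bij_betw (translate_edge ?t) (edges (component a)) (edges (component b))"
    using translate_edge_edges[of _ a b] translate_edge_edges[of _ b a]
      translate_edge_inverse[of _ b ?t] translate_edge_inverse[of _ a "- ?t"]
    by (intro bij_betw_byWitness[where f' = "translate_edge (- ?t)"])
      (simp_all add: image_subset_iff)
  show "\<forall>e\<in>edges (component a). ends (component b) (translate_edge ?t e) =
      translate_vertex ?t ` ends (component a) e"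
  proof
    fix e assume "e \<in> edges (component a)"
    then obtain c j where "e = E c j" "j < k" by (auto simp: edges_component)
    then show "ends (component b) (translate_edge ?t e) = translate_vertex ?t ` ends (component a) e"
      by (simp add: ends_component ends_E add_ac)
  qed
qed

end

section \<open>Free reduction and rotations of words\<close>

lemma inv_letter_inv_letter [simp]: "inv_letter (inv_letter a) = a"
  by (simp add: inv_letter_def)

lemma inv_word_inv_word [simp]: "inv_word (inv_word w) = w"
  by (simp add: inv_word_def rev_map comp_def)

lemma length_inv_word [simp]: "length (inv_word w) = length w"
  by (simp add: inv_word_def)

text \<open>Left multiplication by a letter, acting on reduced words. Folding it over a word
  computes the normal form in the free group.\<close>

fun push :: "'a letter \<Rightarrow> 'a fword \<Rightarrow> 'a fword" where
  "push a [] = [a]"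
| "push a (b # w) = (if b = inv_letter a then w else a # b # w)"

abbreviation free_normal :: "'a fword \<Rightarrow> 'a fword" where
  "free_normal w \<equiv> foldr push w []"

abbreviation freely_reduced :: "'a fword \<Rightarrow> bool" where
  "freely_reduced \<equiv> successively (\<lambda>a b. b \<noteq> inv_letter a)"

lemma freely_reduced_push: "freely_reduced w \<Longrightarrow> freely_reduced (push a w)"
  by (cases w) (auto simp: successively_Cons)

lemma freely_reduced_free_normal: "freely_reduced (free_normal w)"
  by (induction w) (simp_all add: freely_reduced_push)

text \<open>A letter and its inverse act on reduced words as mutually inverse maps; hence cancelling
  such a pair does not change the normal form.\<close>

lemma push_push_inv:
  assumes "freely_reduced w"
  shows "push a (push (inv_letter a) w) = w"
proof (cases w)
  case (Cons b v)
  then show ?thesis using assms by (cases v) auto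
qed simp

lemma free_normal_cancels_step: "cancels_step v w \<Longrightarrow> free_normal v = free_normal w"
  unfolding cancels_step_def
  by (elim exE conjE) (simp add: push_push_inv[OF freely_reduced_free_normal])

lemma free_normal_cong: "free_eq v w \<Longrightarrow> free_normal v = free_normal w"
  unfolding free_eq_def
  by (induction rule: equivclp_induct) (auto dest: free_normal_cancels_step)

lemma free_normal_positive: "positive_word w \<Longrightarrow> free_normal w = w"
proof (induction w)
  case (Cons a w)
  then have "free_normal w = w" "snd a" "\<forall>b\<in>set w. snd b" by (auto simp: positive_word_def)
  then show ?case by (cases w) (auto simp: inv_letter_def)
qed simp

text \<open>Positive words are their own normal forms. This turns non-redundancy, which is stated in
  the free group, into a statement about lists.\<close>

lemma free_eq_positive_iff:
  assumes "positive_word v" "positive_word w"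
  shows "free_eq v w \<longleftrightarrow> v = w"
  using assms free_normal_cong[of v w] free_normal_positive[of v] free_normal_positive[of w]
  by (auto simp: free_eq_def)

lemma free_eq_cancel_right: "free_eq (p @ s) (p @ v @ inv_word v @ s)"
proof (induction v arbitrary: p s)
  case Nil
  show ?case by (simp add: inv_word_def free_eq_def)
next
  case (Cons a v)
  have "cancels_step (p @ [a, inv_letter a] @ s) (p @ s)" unfolding cancels_step_def by blast
  then have "free_eq (p @ s) ((p @ [a]) @ ([inv_letter a] @ s))"
    unfolding free_eq_def by (auto intro: converse_r_into_equivclp)
  moreover have "free_eq \<dots> ((p @ [a]) @ v @ inv_word v @ ([inv_letter a] @ s))" by (rule Cons)
  ultimately have "free_eq (p @ s) ((p @ [a]) @ v @ inv_word v @ ([inv_letter a] @ s))"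
    unfolding free_eq_def by (rule equivclp_trans)
  then show ?case by (simp add: inv_word_def)
qed

section \<open>Conjugation, rotation and inversion of words\<close>

lemma freely_conjugate_rotate:
  assumes "w \<in> words_over X"
  shows "freely_conjugate X (rotate m w) w"
proof -
  \<comment> \<open>The rotated word \<open>v @ u\<close> is the conjugate of \<open>u @ v\<close>
    by \<open>v\<close>: the trailing \<open>v\<close> cancels against its inverse.\<close>
  define u v where "u = take (m mod length w) w" and "v = drop (m mod length w) w"
  have w: "w = u @ v" and r: "rotate m w = v @ u" by (simp_all add: u_def v_def rotate_drop_take)
  have "v \<in> words_over X" using assms unfolding w words_over_def by simp
  moreover have "free_eq (rotate m w) (v @ w @ inv_word v)"
    using free_eq_cancel_right[of "v @ u" "[]" v] unfolding r by (simp add: w)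
  ultimately show ?thesis unfolding freely_conjugate_def by blast
qed

lemma rotate_inverse: "m \<le> length w \<Longrightarrow> rotate (length w - m) (rotate m w) = w"
  by (simp add: rotate_rotate)

text \<open>A rotation that fixes \<open>w\<close> splits it into commuting words \<open>u\<close>
  and \<open>v\<close>, and commuting words are powers of a common word \<open>z\<close>.\<close>

lemma rotate_eq_self_proper_power:
  assumes "rotate m w = w" "0 < m" "m < length w" "w \<in> words_over X"
  shows "proper_power X w"
proof -
  define u v where "u = take m w" and "v = drop m w"
  have w: "w = u @ v" by (simp add: u_def v_def)
  have "u @ v = v @ u" using assms(1,3) by (simp add: rotate_drop_take u_def v_def)
  then obtain s t z where st: "concat (replicate s z) = u" "concat (replicate t z) = v"
    using comm_append_are_replicate by blast
  have "u \<noteq> []" "v \<noteq> []" using assms(2,3) by (auto simp: u_def v_def)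
  then have pos: "s > 0" "t > 0" using st by (auto intro: gr0I)
  have cc: "w = concat (replicate (s + t) z)" by (simp add: w st replicate_add flip: st)
  then have "set z \<subseteq> set w" using pos by (auto simp: set_replicate_conv_if)
  then have "z \<in> words_over X" using assms(4) by (auto simp: words_over_def)
  moreover have "free_eq w (concat (replicate (s + t) z))" by (simp add: free_eq_def flip: cc)
  ultimately show ?thesis unfolding proper_power_def using pos by (intro bexI[of _ z] exI[of _ "s + t"]) auto
qed

lemma inv_word_rotate: "\<exists>m'. inv_word (rotate m w) = rotate m' (inv_word w)"
proof -
  have "rev (rotate m w) = rotate (length w - m mod length w) (rev w)"
    using rotate_rev[of "m" "rev w"] by (metis length_rev rev_rev_ident rotate_rev)
  then show ?thesis by (auto simp: inv_word_def rev_map rotate_map)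
qed

lemma flip_word_flip_word: "length w \<ge> 2 \<Longrightarrow> flip_word (flip_word w) = w"
  by (cases w rule: flip_word.cases) auto

text \<open>The flip of a rotation of an inverse relator is therefore a rotation of the relator
  itself, so every edge of the star graph can be named by a rotation of a relator.\<close>

lemma flip_word_rotate:
  assumes "length w \<ge> 2"
  shows "\<exists>m. flip_word w = rotate m (inv_word w)"
proof -
  obtain a b u where w: "w = a # b # u" using assms by (cases w rule: flip_word.cases) auto
  have "inv_word w = inv_word u @ [inv_letter b, inv_letter a]" by (simp add: w inv_word_def)
  then have "flip_word w = rotate (length (inv_word u)) (inv_word w)"
    by (simp only: rotate_append) (simp add: w)
  then show ?thesis by blast
qed

lemma shift_power:
  assumes "w \<in> words_over {..<n}"
  shows "(shift n ^^ i) w = map (\<lambda>(x, e). ((x + i) mod n, e)) w"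
proof (induction i)
  case 0
  \<comment> \<open>Reduction modulo \<open>n\<close> changes nothing here because all subscripts of
    \<open>w\<close> are below \<open>n\<close>.\<close>
  have "map (\<lambda>(x, e). ((x + 0) mod n, e)) w = map (\<lambda>x. x) w"
    using assms by (intro map_cong) (auto simp: words_over_def)
  then show ?case by simp
next
  case (Suc i)
  then show ?case by (simp add: shift_def split_beta mod_Suc_eq comp_def)
qed

section \<open>The star graph of a positive cyclic presentation\<close>

locale positive_cyclic =
  fixes n k :: nat and w :: "nat fword"
  assumes n_pos: "n > 0" and k_ge: "k \<ge> 3"
    and over: "w \<in> words_over {..<n}"
    and positive: "positive_word w"
    and len: "length w = k"
    and not_power: "\<not> proper_power {..<n} w"
    and non_red: "non_redundant (cyclic_presentation n w)"
begin

abbreviation relator :: "nat \<Rightarrow> nat fword" where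
  "relator i \<equiv> (shift n ^^ i) w"

lemma relator_eq: "relator i = map (\<lambda>(x, e). ((x + i) mod n, e)) w"
  by (rule shift_power[OF over])

lemma length_relator [simp]: "length (relator i) = k"
  by (simp add: relator_eq len)

lemma positive_relator: "positive_word (relator i)"
  using positive by (auto simp: relator_eq positive_word_def)

lemma relator_over: "relator i \<in> words_over {..<n}"
  using n_pos by (auto simp: relator_eq words_over_def)

lemma rels_eq: "rels (cyclic_presentation n w) = relator ` {..<n}"
  by (simp add: cyclic_presentation_def)

lemma gens_eq: "gens (cyclic_presentation n w) = {..<n}"
  by (simp add: cyclic_presentation_def)

lemma relator_nth: "j < k \<Longrightarrow> relator i ! j = ((fst (w ! j) + i) mod n, True)"
  using positive len by (auto simp: relator_eq positive_word_def split_beta)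

lemma relator_inj:
  assumes "relator i = relator i'" "i < n" "i' < n"
  shows "i = i'"
proof -
  have "(fst (w ! 0) + i) mod n = (fst (w ! 0) + i') mod n"
    using relator_nth[of 0 i] relator_nth[of 0 i'] assms(1) k_ge by simp
  then have "[i = i'] (mod n)" unfolding cong_def[symmetric] by (simp add: cong_add_lcancel_nat)
  with assms(2,3) show ?thesis by (simp add: cong_less_modulus_unique_nat)
qed

text \<open>Rotations are conjugate, so non-redundancy keeps different relators apart; that
  \<open>w\<close> is not a proper power keeps the rotations of one relator apart.\<close>

lemma rotate_relator_inj:
  assumes eq: "rotate j (relator i) = rotate j' (relator i')"
    and lt: "i < n" "i' < n" "j < k" "j' < k"
  shows "i = i' \<and> j = j'"
proof -
  have "relator i = rotate (k - j) (rotate j (relator i))"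
    using rotate_inverse[of j "relator i"] lt(3) by simp
  also have "\<dots> = rotate (k - j + j') (relator i')" by (simp add: eq rotate_rotate)
  finally have rot: "relator i = rotate (k - j + j') (relator i')" .
  then have "freely_conjugate {..<n} (relator i) (relator i')"
    using freely_conjugate_rotate[OF relator_over] by metis
  moreover have "relator i \<in> rels (cyclic_presentation n w)" "relator i' \<in> rels (cyclic_presentation n w)"
    using lt by (auto simp: rels_eq)
  ultimately have "free_eq (relator i) (relator i')"
    using non_red unfolding non_redundant_def freely_redundant_def gens_eq by blast
  then have "relator i = relator i'" by (simp add: free_eq_positive_iff positive_relator)
  then have i: "i = i'" using relator_inj lt by blast
  have False if "j \<noteq> j'"
  proof -
    \<comment> \<open>As \<open>j\<close> and \<open>j'\<close> are different and below
      \<open>k\<close>, this rotation is nontrivial.\<close>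
    define m where "m = (k - j + j') mod k"
    have m: "0 < m" "m < k"
      using that lt k_ge by (auto simp: m_def mod_if split: if_splits)
    have "relator i = rotate m (relator i)"
      using rot rotate_conv_mod[of "k - j + j'" "relator i"] by (simp add: i m_def)
    then have *: "map (\<lambda>(x, e). ((x + i) mod n, e)) w = map (\<lambda>(x, e). ((x + i) mod n, e)) (rotate m w)"
      by (simp add: relator_eq rotate_map)
    \<comment> \<open>Adding \<open>i\<close> modulo \<open>n\<close> is injective on letters, so a
      rotation that fixes \<open>relator i\<close> also fixes \<open>w\<close>.\<close>
    have "inj_on (\<lambda>(x, e). ((x + i) mod n, e :: bool)) ({..<n} \<times> UNIV)"
      unfolding cong_def[symmetric]
      by (auto simp: inj_on_def cong_add_rcancel_nat cong_less_modulus_unique_nat simp flip: cong_def)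
    then have "inj_on (\<lambda>(x, e). ((x + i) mod n, e)) (set w \<union> set (rotate m w))"
      by (rule inj_on_subset) (use over in \<open>auto simp: words_over_def\<close>)
    with * have "w = rotate m w" by (simp add: inj_on_map_eq_map)
    then show False using rotate_eq_self_proper_power[of m w] m not_power over len by auto
  qed
  with i show ?thesis by blast
qed

text \<open>Positions are read modulo \<open>k\<close>, so that
  \<open>subscript k = subscript 0\<close> closes the telescoping sum of the steps.\<close>

definition subscript :: "nat \<Rightarrow> int" where
  "subscript j = int (fst (w ! (j mod k)))"

definition step :: "nat \<Rightarrow> int" where
  "step j = (subscript (Suc j) - subscript j) mod int n"

lemma subword_diffs_eq: "subword_diffs n w = image_mset step (mset_set {..<k})"
  unfolding subword_diffs_def len by (intro image_mset_cong) (simp add: step_def subscript_def)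

text \<open>\<open>star_word c j\<close> is the cyclic permutation of a relator that starts with the letter
  coming from position \<open>j\<close> of \<open>w\<close> and whose first subscript is \<open>c\<close>.\<close>

definition star_word :: "int \<Rightarrow> nat \<Rightarrow> nat fword" where
  "star_word c j = rotate j (relator (nat ((c - subscript j) mod int n)))"

definition star_edge :: "int \<Rightarrow> nat \<Rightarrow> nat fword set" where
  "star_edge c j = {star_word c j, flip_word (star_word c j)}"

lemma star_word_nth:
  assumes "m < k"
  shows "star_word c j ! m = vtx n True (c - subscript j + subscript (j + m))"
proof -
  define i where "i = nat ((c - subscript j) mod int n)"
  have "star_word c j ! m = relator i ! ((j + m) mod k)"
    using assms by (simp add: star_word_def nth_rotate flip: i_def)
  also have "\<dots> = ((fst (w ! ((j + m) mod k)) + i) mod n, True)"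
    using k_ge by (intro relator_nth mod_less_divisor) simp
  also have "(fst (w ! ((j + m) mod k)) + i) mod n = nat ((c - subscript j + subscript (j + m)) mod int n)"
  proof -
    have "int ((fst (w ! ((j + m) mod k)) + i) mod n) = (subscript (j + m) + int i) mod int n"
      by (simp add: zmod_int subscript_def)
    also have "\<dots> = (c - subscript j + subscript (j + m)) mod int n"
      using n_pos by (simp add: i_def mod_simps algebra_simps)
    finally show ?thesis by (metis nat_int)
  qed
  finally show ?thesis by (simp add: vtx_def)
qed

lemma length_star_word [simp]: "length (star_word c j) = k"
  by (simp add: star_word_def)

lemma star_word_Cons:
  obtains u where "star_word c j = vtx n True c # vtx n True (c + step j) # u"
proof -
  obtain a b u where ab: "star_word c j = a # b # u"
    using length_star_word[of c j] k_ge by (cases "star_word c j" rule: flip_word.cases) auto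
  have "a = vtx n True c" using star_word_nth[of 0 c j] k_ge by (simp add: ab)
  moreover have "b = vtx n True (c - subscript j + subscript (Suc j))"
    using star_word_nth[of 1 c j] k_ge by (simp add: ab)
  moreover have "\<dots> = vtx n True (c + step j)"
    by (simp add: vtx_def step_def mod_simps algebra_simps)
  ultimately show ?thesis using that ab by simp
qed

lemma inv_letter_vtx [simp]: "inv_letter (vtx n s c) = vtx n (\<not> s) c"
  by (simp add: vtx_def inv_letter_def)

lemma star_word_eq_iff:
  assumes "j < k" "j' < k"
  shows "star_word c j = star_word c' j' \<longleftrightarrow> [c = c'] (mod int n) \<and> j = j'"
proof
  assume "star_word c j = star_word c' j'"
  moreover have "nat (x mod int n) < n" for x using n_pos by (simp add: nat_less_iff)
  ultimately have "nat ((c - subscript j) mod int n) = nat ((c' - subscript j') mod int n) \<and> j = j'"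
    unfolding star_word_def using assms by (intro rotate_relator_inj)
  then have "[c - subscript j = c' - subscript j] (mod int n)" "j = j'"
    using n_pos by (auto simp: cong_def eq_nat_nat_iff)
  then show "[c = c'] (mod int n) \<and> j = j'"
    using cong_add[OF _ cong_refl[of "subscript j"]] by fastforce
next
  assume *: "[c = c'] (mod int n) \<and> j = j'"
  then have "[c - subscript j = c' - subscript j'] (mod int n)" by (intro cong_diff) auto
  with * show "star_word c j = star_word c' j'" by (simp add: star_word_def cong_def)
qed

lemma star_edge_eq_iff:
  assumes "j < k" "j' < k"
  shows "star_edge c j = star_edge c' j' \<longleftrightarrow> [c = c'] (mod int n) \<and> j = j'"
proof -
  \<comment> \<open>A star word begins with a positive letter and a flipped one with a negative
    letter. So each edge contains exactly one star word.\<close>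
  have "star_word c j \<noteq> flip_word (star_word c' j')"
    by (rule star_word_Cons[of c j], rule star_word_Cons[of c' j']) (simp, simp add: vtx_def)
  then have "star_edge c j = star_edge c' j' \<longleftrightarrow> star_word c j = star_word c' j'"
    unfolding star_edge_def by auto
  then show ?thesis using star_word_eq_iff[OF assms] by simp
qed

lemma rotate_relator_star_edge:
  assumes "i < n"
  shows "\<exists>c j. j < k \<and> {rotate m (relator i), flip_word (rotate m (relator i))} = star_edge c j"
proof -
  let ?j = "m mod k"
  have "rotate m (relator i) = rotate ?j (relator i)"
    using rotate_conv_mod[of m "relator i"] by simp
  \<comment> \<open>The first letter of the rotated relator is the one at position \<open>?j\<close>
    of \<open>w\<close> with its subscript shifted by \<open>i\<close>, whence this choice of
    \<open>c\<close>.\<close>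
  also have "\<dots> = star_word (int i + subscript ?j) ?j"
    using assms by (simp add: star_word_def)
  finally have "{rotate m (relator i), flip_word (rotate m (relator i))} =
      star_edge (int i + subscript ?j) ?j" by (simp add: star_edge_def)
  moreover have "?j < k" using k_ge by simp
  ultimately show ?thesis by blast
qed

lemma edges_star_graph:
  "edges (star_graph (cyclic_presentation n w)) = {star_edge c j | c j. j < k}"
proof (intro equalityI subsetI)
  fix e assume "e \<in> edges (star_graph (cyclic_presentation n w))"
  then obtain v where v: "e = {v, flip_word v}" "length v \<ge> 2"
    "v \<in> sym_closure (relator ` {..<n})"
    by (auto simp: star_graph_def rels_eq)
  then obtain m i where mi: "i < n" "v = rotate m (relator i) \<or> v = rotate m (inv_word (relator i))"
    unfolding sym_closure_def by auto
  from mi(2) have "\<exists>m. e = {rotate m (relator i), flip_word (rotate m (relator i))}"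
  proof
    assume v': "v = rotate m (inv_word (relator i))"
    obtain m1 where "flip_word v = rotate m1 (inv_word v)" using flip_word_rotate[OF v(2)] by blast
    moreover obtain m2 where "inv_word v = rotate m2 (inv_word (inv_word (relator i)))"
      using inv_word_rotate[of m "inv_word (relator i)"] v' by blast
    ultimately have "flip_word v = rotate (m1 + m2) (relator i)" by (simp add: rotate_rotate)
    moreover have "e = {flip_word v, flip_word (flip_word v)}"
      by (simp add: v(1) flip_word_flip_word[OF v(2)] insert_commute)
    ultimately show ?thesis by auto
  qed (use v(1) in auto)
  then show "e \<in> {star_edge c j | c j. j < k}" using rotate_relator_star_edge[OF mi(1)] by blast
next
  fix e assume "e \<in> {star_edge c j | c j. j < k}"
  then obtain c j where e: "e = star_edge c j" by blast
  define i where "i = nat ((c - subscript j) mod int n)"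
  have "i < n" using n_pos by (simp add: i_def nat_less_iff)
  then have "star_word c j \<in> sym_closure (relator ` {..<n})"
    unfolding sym_closure_def star_word_def i_def[symmetric] by blast
  then show "e \<in> edges (star_graph (cyclic_presentation n w))"
    using k_ge by (auto simp: e star_edge_def star_graph_def rels_eq intro!: exI[of _ "star_word c j"])
qed

lemma ends_star_edge:
  "ends (star_graph (cyclic_presentation n w)) (star_edge c j) =
     {vtx n True c, vtx n False (c + step j)}"
  by (rule star_word_Cons[of c j]) (auto simp: star_graph_def star_edge_def)

sublocale bicirculant "star_graph (cyclic_presentation n w)" star_edge step n k
proof
  show "verts (star_graph (cyclic_presentation n w)) = {..<n} \<times> UNIV"
    by (simp add: star_graph_def gens_eq)
qed (use n_pos k_ge in \<open>simp_all add: edges_star_graph star_edge_eq_iff ends_star_edge\<close>)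

text \<open>Modulo \<nu> the subscripts along \<open>w\<close> form an arithmetic progression with
  increment \<open>step 0\<close>. Its return to the start after \<open>k\<close> steps gives
  divisibility of \<open>k * step 0\<close>, and the same progression shows that
  \<open>step 0\<close> is prime to \<nu>.\<close>

lemma dvd_length:
  assumes "\<nu> dvd n" "0 \<in> fst ` set w" "irreducible_cyclic n w"
    and cong: "\<And>i j. i < k \<Longrightarrow> j < k \<Longrightarrow> [step i = step j] (mod int \<nu>)"
  shows "\<nu> dvd k"
proof -
  have step: "[subscript (Suc j) = subscript j + step 0] (mod int \<nu>)" if "j < k" for j
  proof -
    have "[step j = subscript (Suc j) - subscript j] (mod int n)"
      by (simp add: step_def)
    then have "[step j = subscript (Suc j) - subscript j] (mod int \<nu>)"
      using assms(1) by (meson cong_dvd_modulus int_dvd_int_iff)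
    then have "[subscript (Suc j) - subscript j = step 0] (mod int \<nu>)"
      using cong[of j 0] that k_ge by (metis cong_sym cong_trans gr0I not_less_zero)
    then show ?thesis by (simp add: cong_iff_dvd_diff algebra_simps)
  qed
  have sub: "[subscript j = subscript 0 + int j * step 0] (mod int \<nu>)" if "j \<le> k" for j
    using that
  proof (induction j)
    case (Suc j)
    then have "[subscript j + step 0 = subscript 0 + int j * step 0 + step 0] (mod int \<nu>)"
      by (intro cong_add) auto
    with step[of j] Suc.prems show ?case
      by (auto intro: cong_trans simp: algebra_simps)
  qed simp
  have k_step: "int \<nu> dvd int k * step 0"
    using sub[of k] by (simp add: subscript_def cong_iff_dvd_diff)
  define g where "g = gcd (int \<nu>) (step 0)"
  have g_sub: "g dvd subscript j - subscript 0" if "j < k" for j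
  proof -
    have "g dvd subscript j - (subscript 0 + int j * step 0)"
      using sub[of j] that by (auto simp: g_def cong_iff_dvd_diff intro: dvd_trans[OF gcd_dvd1])
    moreover have "g dvd int j * step 0" by (simp add: g_def)
    ultimately show ?thesis using dvd_add[of g] by fastforce
  qed
  \<comment> \<open>So far \<open>g\<close> divides only differences of subscripts. An occurrence of
    the subscript 0 makes it divide all subscripts, hence the gcd in
    \<open>irreducible_cyclic\<close>.\<close>
  obtain m where m: "m < k" "subscript m = 0"
    using assms(2) len by (auto simp: in_set_conv_nth subscript_def)
  then have "g dvd subscript 0" using g_sub[of m] by simp
  then have g_subscript: "g dvd subscript j" if "j < k" for j
    using g_sub[OF that] dvd_add[of g "subscript j - subscript 0" "subscript 0"] by simp
  have "nat g dvd x" if "x \<in> insert n (fst ` set w)" for x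
  proof -
    have "g dvd int x"
    proof (cases "x = n")
      case True
      then show ?thesis using assms(1) by (auto simp: g_def intro: dvd_trans[OF gcd_dvd1])
    next
      case False
      with that obtain j where "j < k" "x = fst (w ! j)" using len by (auto simp: in_set_conv_nth)
      then show ?thesis using g_subscript[of j] by (simp add: subscript_def)
    qed
    then show ?thesis by (simp add: g_def nat_dvd_iff)
  qed
  then have "nat g dvd 1" using assms(3) unfolding irreducible_cyclic_def by (metis Gcd_greatest)
  then have "g = 1" by (simp add: g_def)
  then have "coprime (int \<nu>) (step 0)" by (simp add: g_def coprime_iff_gcd_eq_1)
  then have "int \<nu> dvd int k" using k_step coprime_dvd_mult_left_iff by blast
  then show ?thesis by simp
qed

section \<open>The two implications\<close>

lemma special_imp_difference_set:
  assumes "special 3 k \<nu> (cyclic_presentation n w)" "0 \<in> fst ` set w" "irreducible_cyclic n w"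
  shows "n = \<nu> * (k\<^sup>2 - k + 1)" "perfect_difference_set k (subword_diffs n w)"
    "\<And>i j. i < k \<Longrightarrow> j < k \<Longrightarrow> [step i = step j] (mod int \<nu>)" "\<nu> dvd k"
proof -
  let ?G = "star_graph (cyclic_presentation n w)"
  let ?N = "k\<^sup>2 - k + 1"
  have "card (graph_components ?G) = \<nu>"
    "\<And>C. C \<in> graph_components ?G \<Longrightarrow> graph_diameter C = enat 3 \<and> graph_girth C = enat 6"
    using assms(1) by (simp_all add: special_def)
  note nec = components_imp_differences[OF this]
  show n: "n = \<nu> * (k\<^sup>2 - k + 1)" by (rule nec(2))
  show cong: "[step i = step j] (mod int \<nu>)" if "i < k" "j < k" for i j
    using nec(3) that by blast
  show \<nu>: "\<nu> dvd k"
    using n by (intro dvd_length assms cong) auto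
  \<comment> \<open>\<nu> and \<open>?N\<close> are coprime with product \<open>n\<close>, so
    congruences modulo both combine. Differences of steps all vanish modulo \<nu>, so those that
    agree modulo \<open>?N\<close> agree modulo \<open>n\<close>.\<close>
  have modn: "[x = y] (mod int n)"
    if "[x = y] (mod int ?N)" "[x = y] (mod int \<nu>)" for x y
    using coprime_cong_mult[OF that(2,1)] coprime_order_modulus[OF \<nu>] unfolding n of_nat_mult by blast
  let ?\<phi> = "\<lambda>(i, j). (step i - step j) mod int ?N"
  have inj: "inj_on ?\<phi> (off_diagonal k)"
  proof (rule inj_onI)
    fix x y assume xy: "x \<in> off_diagonal k" "y \<in> off_diagonal k" "?\<phi> x = ?\<phi> y"
    obtain i j i' j' where eq: "x = (i, j)" "y = (i', j')" by (cases x, cases y)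
    have lt: "i < k" "j < k" "i' < k" "j' < k" using xy by (auto simp: off_diagonal_def eq)
    have "[step i - step j = step i' - step j'] (mod int n)"
    proof (rule modn)
      show "[step i - step j = step i' - step j'] (mod int ?N)" using xy(3) by (simp add: eq cong_def)
      show "[step i - step j = step i' - step j'] (mod int \<nu>)"
        using cong_diff[OF cong[of i i'] cong[of j j']] lt by simp
    qed
    then show "x = y" using nec(1) xy(1,2) unfolding distinct_differences_def off_diagonal_def eq by blast
  qed
  moreover have "?\<phi> ` off_diagonal k \<subseteq> {1..int (k\<^sup>2 - k)}"
  proof
    fix r assume "r \<in> ?\<phi> ` off_diagonal k"
    then obtain i j where ij: "i < k" "j < k" "i \<noteq> j" "r = (step i - step j) mod int ?N"
      by (auto simp: off_diagonal_def)
    have "r \<noteq> 0"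
    proof
      assume "r = 0"
      then have "[step i = step j] (mod int ?N)"
        using ij(4) by (simp add: cong_iff_dvd_diff mod_eq_0_iff_dvd)
      then have "[step i = step j] (mod int n)" using modn cong ij by blast
      then show False using nec(1) ij unfolding distinct_differences_def by blast
    qed
    moreover have "0 \<le> r" "r < int ?N" unfolding ij(4) by simp_all
    ultimately have "1 \<le> r" "r \<le> int (k\<^sup>2 - k)" by linarith+
    then show "r \<in> {1..int (k\<^sup>2 - k)}" by (simp only: atLeastAtMost_iff)
  qed
  moreover have "card (?\<phi> ` off_diagonal k) = card {1..int (k\<^sup>2 - k)}"
    using card_image[OF inj] by simp
  ultimately have "bij_betw ?\<phi> (off_diagonal k) {1..int (k\<^sup>2 - k)}"
    unfolding bij_betw_def by (metis card_subset_eq finite_atLeastAtMost_int)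
  then show "perfect_difference_set k (subword_diffs n w)"
    unfolding subword_diffs_eq perfect_difference_set_iff_bij .
qed

lemma difference_set_imp_special:
  assumes n: "n = \<nu> * (k\<^sup>2 - k + 1)" and pds: "perfect_difference_set k (subword_diffs n w)"
    and cong: "\<And>i j. i < k \<Longrightarrow> j < k \<Longrightarrow> [step i = step j] (mod int \<nu>)"
    and \<nu>: "\<nu> dvd k"
  shows "special 3 k \<nu> (cyclic_presentation n w)"
proof -
  let ?G = "star_graph (cyclic_presentation n w)"
  let ?N = "k\<^sup>2 - k + 1"
  let ?\<phi> = "\<lambda>(i, j). (step i - step j) mod int ?N"
  have bij: "bij_betw ?\<phi> (off_diagonal k) {1..int (k\<^sup>2 - k)}"
    using pds unfolding subword_diffs_eq perfect_difference_set_iff_bij .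
  have modn: "[x = y] (mod int n)"
    if "[x = y] (mod int ?N)" "[x = y] (mod int \<nu>)" for x y
    using coprime_cong_mult[OF that(2,1)] coprime_order_modulus[OF \<nu>] unfolding n of_nat_mult by blast
  have modN: "[x = y] (mod int ?N)" if "[x = y] (mod int n)" for x y
    by (rule cong_dvd_modulus[OF that]) (simp only: n of_nat_mult dvd_triv_right)
  have dd: distinct_differences
    unfolding distinct_differences_def
  proof (intro conjI allI impI)
    fix i j assume ij: "i < k" "j < k" "[step i = step j] (mod int n)"
    show "i = j"
    proof (rule ccontr)
      assume "i \<noteq> j"
      then have "?\<phi> (i, j) \<in> {1..int (k\<^sup>2 - k)}"
        using bij_betwE[OF bij] ij by (auto simp: off_diagonal_def)
      moreover have "?\<phi> (i, j) = 0"
        using modN[OF ij(3)] by (simp add: cong_iff_dvd_diff)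
      ultimately show False by simp
    qed
  next
    fix i j i' j'
    assume *: "i < k" "j < k" "i' < k" "j' < k" "i \<noteq> j" "i' \<noteq> j'"
      "[step i - step j = step i' - step j'] (mod int n)"
    have "?\<phi> (i, j) = ?\<phi> (i', j')" using modN[OF *(7)] by (simp add: cong_def)
    then have "(i, j) = (i', j')"
      using * by (intro inj_onD[OF bij_betw_imp_inj_on[OF bij]]) (auto simp: off_diagonal_def)
    then show "i = i'" "j = j'" by simp_all
  qed
  \<comment> \<open>The perfect difference set solves the congruence modulo \<open>?N\<close>.
    Modulo \<nu> both sides vanish, so the solution is valid modulo \<open>n\<close>. The residue 0
    is not among the differences of distinct positions and takes equal indices.\<close>
  have diff_ex: "\<exists>i<k. \<exists>j<k. [c = step i - step j] (mod int n)" if "int \<nu> dvd c" for c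
  proof (cases "c mod int ?N = 0")
    case True
    then have "[c = step 0 - step 0] (mod int n)"
      using that by (intro modn) (auto simp: cong_iff_dvd_diff)
    then show ?thesis using k_ge by (intro exI[of _ 0] conjI) auto
  next
    case False
    have "0 \<le> c mod int ?N" "c mod int ?N < int ?N" by simp_all
    with False have "1 \<le> c mod int ?N" "c mod int ?N \<le> int (k\<^sup>2 - k)" by linarith+
    then have "c mod int ?N \<in> {1..int (k\<^sup>2 - k)}" by (simp only: atLeastAtMost_iff)
    then have "c mod int ?N \<in> ?\<phi> ` off_diagonal k"
      by (simp only: bij_betw_imp_surj_on[OF bij])
    then obtain x where x: "c mod int ?N = ?\<phi> x" "x \<in> off_diagonal k" by (rule imageE)
    obtain i j where ij: "x = (i, j)" by (cases x)
    have lt: "i < k" "j < k" using x(2) by (auto simp: ij off_diagonal_def)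
    have "[c = step i - step j] (mod int n)"
    proof (rule modn)
      show "[c = step i - step j] (mod int ?N)" using x(1) by (simp add: ij cong_def)
      show "[c = step i - step j] (mod int \<nu>)"
        using cong[OF lt] that by (simp add: cong_iff_dvd_diff)
    qed
    then show ?thesis using lt by blast
  qed
  interpret projective_bicirculant ?G star_edge step n k \<nu>
    using n cong dd diff_ex by unfold_locales auto
  have comps: "C \<in> graph_components ?G \<Longrightarrow> \<exists>a. C = component a" for C
    unfolding components_eq by blast
  have "finite (rels (cyclic_presentation n w))" "finite (gens (cyclic_presentation n w))"
    by (simp_all add: rels_eq gens_eq)
  moreover have "\<forall>r\<in>rels (cyclic_presentation n w). cyclically_reduced r \<and> length r = k"
    by (auto simp: rels_eq intro: positive_word_cyclically_reduced positive_relator)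
  moreover have "rels (cyclic_presentation n w) \<subseteq> words_over (gens (cyclic_presentation n w))"
    using relator_over by (auto simp: rels_eq gens_eq)
  moreover have "\<forall>C\<in>graph_components ?G. \<forall>D\<in>graph_components ?G. graph_iso C D"
    using comps components_iso by blast
  moreover have "\<forall>C\<in>graph_components ?G. connected_graph C \<and> bipartite_graph C \<and>
      graph_diameter C = enat 3 \<and> graph_girth C = enat 6 \<and> (\<forall>v\<in>verts C. graph_degree C v \<ge> 3)"
    using comps component_connected component_bipartite component_diameter component_girth
      component_degree by blast
  ultimately show ?thesis
    unfolding special_def using components_card \<nu>_pos k_ge by simp
qed

end

theorem theorem2:
  fixes n \<nu> k :: nat and w :: "nat fword"
  assumes "n \<ge> 1" and "\<nu> \<ge> 1" and "k \<ge> 3"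
    and "w \<in> words_over {..<n}"
    and "0 \<in> fst ` set w"
    and "positive_word w"
    and "length w = k"
    and "\<not> proper_power {..<n} w"
    and "irreducible_cyclic n w"
    and "non_redundant (cyclic_presentation n w)"
  shows "special 3 k \<nu> (cyclic_presentation n w) \<longleftrightarrow>
     n = \<nu> * (k^2 - k + 1) \<and>
     perfect_difference_set k (subword_diffs n w) \<and>
     (\<forall>q\<in>#subword_diffs n w. \<forall>q'\<in>#subword_diffs n w. [q = q'] (mod int \<nu>)) \<and>
     \<nu> dvd k"
proof -
  interpret positive_cyclic n k w
    using assms by unfold_locales auto
  have "(\<forall>q\<in>#subword_diffs n w. \<forall>q'\<in>#subword_diffs n w. [q = q'] (mod int \<nu>)) \<longleftrightarrow>
      (\<forall>i<k. \<forall>j<k. [step i = step j] (mod int \<nu>))"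
    unfolding subword_diffs_eq by auto
  then show ?thesis using special_imp_difference_set[OF _ assms(5,9)] difference_set_imp_special by blast
qed

end
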